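(* Let $T$ be a rank-one transformation on a probability space which is not an odometer, and let $p$ be the word complexity function of its associated subshift $X(T)$. Then $$\limsup_{q\to\infty}\big(p(q)-1.5q\big)=\infty \quad\text{and}\quad \liminf_{q\to\infty}\big(p(q)-q\big)=\infty.$$
   Context: Rank-one transformations: a rank-one transformation $T$ is specified by a cut sequence $(r_n)_{n\ge1}$ of positive integers and a spacer sequence $(s_{n,i})_{n\ge 1,\,0\le i\le r_n}$ of nonnegative integers via cutting and stacking: $C_1=[0,1)$ is a column of height $h_1=1$; given the column $C_n$ (levels $I_{n,0},\dots,I_{n,h_n-1}$, intervals of equal length, $T$ mapping $I_{n,j}$ affinely onto $I_{n,j+1}$), cut $C_n$ vertically into $r_n+1$ subcolumns of equal width (subcolumn $i$, $i=0$ leftmost, has sublevels $I^{[i]}_{n,j}$), put $s_{n,i}$ new intervals (spacers) of the same width on top of subcolumn $i$, and stack each subcolumn (with its spacers) on top of the previous one to obtain $C_{n+1}$. $T$ is the limit map; it preserves Lebesgue measure, and the space has finite measure iff $\sum_n\frac{1}{r_nh_n}\sum_{i}s_{n,i}<\infty$ (then one normalizes to a probability measure). The associated subshift $X(T)\subseteq\{0,1\}^{\mathbb Z}$ is defined by words $B_1=0$, $B_{n+1}=B_n1^{s_{n,0}}B_n1^{s_{n,1}}\cdots B_n1^{s_{n,r_n}}$ (so $h_n$ is the length of $B_n$): $X(T)$ is the set of biinfinite sequences every finite subword of which is a subword of some $B_n$. The word complexity $p(q)$ is the number of distinct words of length $q$ occurring in elements of $X(T)$. $T$ is an odometer if it can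 be obtained (up to measure-theoretic isomorphism) from a rank-one construction whose spacer sequence satisfies, for some $N$, $s_{n,i}=0$ for all $n\ge N$ and $0\le i<r_n$. *)

theory Defs
  imports "HOL-Analysis.Analysis" "HOL-Library.Liminf_Limsup"
begin

text \<open>Rank-one data, indexed from 0: stage n here is stage n+1 of the paper.
  r n is the cut number r_(n+1), s n i the spacer number s_(n+1,i) (0 <= i <= r n).
  Column C_n (n = 0 is C_1 = [0,1)) has height ro_hgt r s n and width ro_wid r n.\<close>

primrec ro_hgt :: "(nat \<Rightarrow> nat) \<Rightarrow> (nat \<Rightarrow> nat \<Rightarrow> nat) \<Rightarrow> nat \<Rightarrow> nat" where
  "ro_hgt r s 0 = 1"
| "ro_hgt r s (Suc n) = (r n + 1) * ro_hgt r s n + (\<Sum>i\<le>r n. s n i)"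

primrec ro_wid :: "(nat \<Rightarrow> nat) \<Rightarrow> nat \<Rightarrow> real" where
  "ro_wid r 0 = 1"
| "ro_wid r (Suc n) = ro_wid r n / real (r n + 1)"

definition ro_blockstart :: "(nat \<Rightarrow> nat) \<Rightarrow> (nat \<Rightarrow> nat \<Rightarrow> nat) \<Rightarrow> nat \<Rightarrow> nat \<Rightarrow> nat" where
  "ro_blockstart r s n i = (\<Sum>k<i. ro_hgt r s n + s n k)"

text \<open>Left endpoint of level k of column C_n.  The levels of C_n tile
  [0, hgt n * wid n); the spacers added at stage n are taken (left to right, in the
  order subcolumn 0, 1, ..., r n) from the interval immediately to the right.\<close>
primrec ro_lev :: "(nat \<Rightarrow> nat) \<Rightarrow> (nat \<Rightarrow> nat \<Rightarrow> nat) \<Rightarrow> nat \<Rightarrow> nat \<Rightarrow> real" where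
  "ro_lev r s 0 k = 0"
| "ro_lev r s (Suc n) k =
     (let i = (LEAST i. k < ro_blockstart r s n (Suc i));
          d = k - ro_blockstart r s n i
      in if d < ro_hgt r s n
         then ro_lev r s n d + real i * ro_wid r (Suc n)
         else real (ro_hgt r s n) * ro_wid r n
              + real ((\<Sum>k'<i. s n k') + (d - ro_hgt r s n)) * ro_wid r (Suc n))"

definition ro_level :: "(nat \<Rightarrow> nat) \<Rightarrow> (nat \<Rightarrow> nat \<Rightarrow> nat) \<Rightarrow> nat \<Rightarrow> nat \<Rightarrow> real set" where
  "ro_level r s n k = {ro_lev r s n k ..< ro_lev r s n k + ro_wid r n}"

definition ro_space :: "(nat \<Rightarrow> nat) \<Rightarrow> (nat \<Rightarrow> nat \<Rightarrow> nat) \<Rightarrow> real set" where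
  "ro_space r s = (\<Union>n. \<Union>k\<in>{..<ro_hgt r s n}. ro_level r s n k)"

text \<open>The limit map T: on a non-top level of some column it is the translation onto the
  next level (independent of the column chosen); elsewhere (a null set) the identity.\<close>
definition ro_map :: "(nat \<Rightarrow> nat) \<Rightarrow> (nat \<Rightarrow> nat \<Rightarrow> nat) \<Rightarrow> real \<Rightarrow> real" where
  "ro_map r s x =
    (if \<exists>n k. Suc k < ro_hgt r s n \<and> x \<in> ro_level r s n k
     then (let (n, k) = (SOME (n, k). Suc k < ro_hgt r s n \<and> x \<in> ro_level r s n k)
           in x - ro_lev r s n k + ro_lev r s n (Suc k))
     else x)"

text \<open>Valid rank-one data on a finite measure space (r_n positive, finiteness criterion).\<close>
definition ro_valid :: "(nat \<Rightarrow> nat) \<Rightarrow> (nat \<Rightarrow> nat \<Rightarrow> nat) \<Rightarrow> bool" where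
  "ro_valid r s \<longleftrightarrow> (\<forall>n. r n \<ge> 1) \<and>
     summable (\<lambda>n. real (\<Sum>i\<le>r n. s n i) / (real (r n) * real (ro_hgt r s n)))"

definition ro_measure :: "(nat \<Rightarrow> nat) \<Rightarrow> (nat \<Rightarrow> nat \<Rightarrow> nat) \<Rightarrow> real measure" where
  "ro_measure r s = scale_measure (inverse (emeasure lborel (ro_space r s)))
                       (restrict_space lborel (ro_space r s))"

definition mt_iso :: "'a measure \<Rightarrow> ('a \<Rightarrow> 'a) \<Rightarrow> 'b measure \<Rightarrow> ('b \<Rightarrow> 'b) \<Rightarrow> bool" where
  "mt_iso M T N S \<longleftrightarrow> (\<exists>A B \<phi>.
     A \<in> sets M \<and> B \<in> sets N \<and>
     emeasure M (space M - A) = 0 \<and> emeasure N (space N - B) = 0 \<and>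
     T ` A \<subseteq> A \<and> S ` B \<subseteq> B \<and>
     bij_betw \<phi> A B \<and>
     \<phi> \<in> restrict_space M A \<rightarrow>\<^sub>M restrict_space N B \<and>
     the_inv_into A \<phi> \<in> restrict_space N B \<rightarrow>\<^sub>M restrict_space M A \<and>
     (\<forall>C \<in> sets (restrict_space M A). emeasure N (\<phi> ` C) = emeasure M C) \<and>
     (\<forall>x\<in>A. \<phi> (T x) = S (\<phi> x)))"

definition ro_odometer :: "(nat \<Rightarrow> nat) \<Rightarrow> (nat \<Rightarrow> nat \<Rightarrow> nat) \<Rightarrow> bool" where
  "ro_odometer r s \<longleftrightarrow> (\<exists>r' s'. ro_valid r' s' \<and>
     (\<exists>N. \<forall>n\<ge>N. \<forall>i<r' n. s' n i = 0) \<and>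
     mt_iso (ro_measure r s) (ro_map r s) (ro_measure r' s') (ro_map r' s'))"

text \<open>The words B_n (0 is the column symbol, 1 the spacer symbol).\<close>
primrec ro_word :: "(nat \<Rightarrow> nat) \<Rightarrow> (nat \<Rightarrow> nat \<Rightarrow> nat) \<Rightarrow> nat \<Rightarrow> nat list" where
  "ro_word r s 0 = [0]"
| "ro_word r s (Suc n) = concat (map (\<lambda>i. ro_word r s n @ replicate (s n i) 1) [0..<Suc (r n)])"

definition ro_subshift :: "(nat \<Rightarrow> nat) \<Rightarrow> (nat \<Rightarrow> nat \<Rightarrow> nat) \<Rightarrow> (int \<Rightarrow> nat) set" where
  "ro_subshift r s = {x. \<forall>k::int. \<forall>q::nat. \<exists>n ps ss.
       ro_word r s n = ps @ map (\<lambda>i. x (k + int i)) [0..<q] @ ss}"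

definition ro_complexity :: "(nat \<Rightarrow> nat) \<Rightarrow> (nat \<Rightarrow> nat \<Rightarrow> nat) \<Rightarrow> nat \<Rightarrow> nat" where
  "ro_complexity r s q = card {w. \<exists>x\<in>ro_subshift r s. \<exists>k::int.
       w = map (\<lambda>i. x (k + int i)) [0..<q]}"

end

theory Submission
  imports Defs "HOL-Library.Sublist"
begin

text \<open>
  Write \<open>E(q) = p(q) - q\<close>. Since \<open>p(q + 1) - p(q)\<close> is the number of right-special words of
  length \<open>q\<close>, \<open>E\<close> is monotone, and two right-special words that differ \<open>l\<close> letters before their
  end force \<open>E\<close> to grow by one at every length between \<open>l\<close> and their lengths. Stripping trailing
  spacers from \<open>B_n\<close> gives words \<open>b_n\<close>, each a concatenation of copies of \<open>b_(n-1)\<close> separated by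
  gaps.

  If for every \<open>n\<close> at least three gaps occur between copies of \<open>b_n\<close>, let \<open>c < x\<close> be the two smallest;
  the words \<open>1^c b_n 1^c\<close> and \<open>1^c b_n 1^x\<close> are right-special and already differ after \<open>c\<close> letters.
  Otherwise the gaps are eventually two fixed numbers \<open>c < d\<close>. In the language of gap sequences
  over \<open>{c, d}\<close>, short right-special words produce a long interval of lengths on which \<open>E\<close> grows, so
  that \<open>E(q) \<ge> q/2 + E(|b_n|) - O(1)\<close> for some \<open>q \<ge> |b_n|\<close>, unless one letter is isolated and the
  runs of the other have length exactly \<open>m\<close> or \<open>2 m + 1\<close>. In that exceptional case \<open>m + 1\<close> blocks
  can be merged into a new block with the same two gaps, and the growth gained at
  two consecutive coarsenings suffices.

  If only one gap occurs between copies of some \<open>b_n\<close>, then all return times to the base of the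
  \<open>n\<close>-th column agree, and mapping levels affinely to levels of an odometer column is an isomorphism.
\<close>

section \<open>Words built from blocks and gaps\<close>

text \<open>Copies of \<open>B\<close> stand at both ends, so spacers occur only between copies.
  Hence block words joined by gaps are again block words over the same \<open>B\<close>.\<close>

definition block_word :: "nat list \<Rightarrow> nat list \<Rightarrow> nat list" where
  "block_word B gs = B @ concat (map (\<lambda>g. replicate g 1 @ B) gs)"

definition join_word :: "'a list \<Rightarrow> 'a list \<Rightarrow> 'a list" where
  "join_word V hs = V @ concat (map (\<lambda>h. h # V) hs)"

lemma block_word_Nil [simp]: "block_word B [] = B"
  by (simp add: block_word_def)

lemma block_word_Cons [simp]:
  "block_word B (g # gs) = B @ replicate g 1 @ block_word B gs"
  by (simp add: block_word_def)

lemma block_word_append: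
  "block_word B (xs @ y # ys) = block_word B xs @ replicate y 1 @ block_word B ys"
  by (induction xs) auto

lemma join_word_Nil [simp]: "join_word V [] = V"
  by (simp add: join_word_def)

lemma join_word_Cons [simp]: "join_word V (h # hs) = V @ h # join_word V hs"
  by (simp add: join_word_def)

lemma join_word_append:
  "join_word V (xs @ y # ys) = join_word V xs @ y # join_word V ys"
  by (induction xs) auto

text \<open>Change of scale: a word over the coarser block \<open>block_word B V\<close> is also a
  word over \<open>B\<close>, and \<open>join_word\<close> computes its gap sequence there. All
  later comparisons between stages rest on this identity.\<close>

lemma block_word_join_word:
  "block_word B (join_word V hs) = block_word (block_word B V) hs"
  by (induction hs) (auto simp: block_word_append)

lemma set_join_word: "set (join_word V hs) = set V \<union> set hs"
  by (induction hs) auto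

lemma length_block_word:
  "length (block_word B gs) = length B + (\<Sum>g\<leftarrow>gs. length B + g)"
  by (induction gs) auto

lemma block_word_first:
  "B = 0 # B' \<Longrightarrow> \<exists>T. block_word B gs = 0 # T"
  by (cases gs) auto

lemma block_word_last:
  "B = B' @ [0] \<Longrightarrow> \<exists>T. block_word B gs = T @ [0]"
  by (induction gs) auto

lemma prefix_block_word_append: "prefix (block_word B xs) (block_word B (xs @ ys))"
  by (cases ys) (auto simp: block_word_append)

lemma suffix_block_word_append: "suffix (block_word B ys) (block_word B (xs @ ys))"
  by (cases xs rule: rev_cases) (auto simp: block_word_append suffix_def)

lemma sublist_block_word:
  assumes "sublist xs ys" shows "sublist (block_word B xs) (block_word B ys)"
proof -
  obtain ps ss where "ys = ps @ xs @ ss" using assms by (auto simp: sublist_def)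
  then show ?thesis
    by (metis prefix_block_word_append suffix_block_word_append
        prefix_imp_sublist suffix_imp_sublist sublist_order.order.trans)
qed

lemma prefix_join_word_append: "prefix (join_word B xs) (join_word B (xs @ ys))"
  by (cases ys) (auto simp: join_word_append)

section \<open>Right-special words\<close>

text \<open>Aperiodicity enters through \<open>special\<close>: since every length has a
  right-special word, the excess never decreases.\<close>

locale special_lang =
  fixes L :: "nat list set"
  assumes factorial: "w \<in> L \<Longrightarrow> sublist u w \<Longrightarrow> u \<in> L"
    and letters: "w \<in> L \<Longrightarrow> set w \<subseteq> {0, 1}"
    and right_ext: "w \<in> L \<Longrightarrow> \<exists>a. w @ [a] \<in> L"
    and special: "\<exists>w. length w = q \<and> w @ [0] \<in> L \<and> w @ [1] \<in> L"
begin

definition right_special :: "nat list set" where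
  "right_special = {w. w @ [0] \<in> L \<and> w @ [1] \<in> L}"

definition excess :: "nat \<Rightarrow> int" where
  "excess q = int (card {w \<in> L. length w = q}) - int q"

lemma finite_words: "finite {w \<in> L. length w = q}"
proof (rule finite_subset)
  show "{w \<in> L. length w = q} \<subseteq> {w. set w \<subseteq> {0, 1} \<and> length w = q}"
    using letters by auto
qed (simp add: finite_lists_length_eq)

lemma right_special_in_L: "w \<in> right_special \<Longrightarrow> w \<in> L"
  unfolding right_special_def using factorial[of "w @ [0]" w] by auto

lemma right_special_suffix: "u @ w \<in> right_special \<Longrightarrow> w \<in> right_special"
  unfolding right_special_def using factorial[of "u @ w @ [0]" "w @ [0]"]
    factorial[of "u @ w @ [1]" "w @ [1]"] by (auto simp: sublist_def)

text \<open>Inclusion-exclusion: the words of length \<open>q\<close> extendable by 0 and those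
  extendable by 1 cover all words of length \<open>q\<close>, and they meet in the right-special
  ones.\<close>

lemma excess_Suc: "excess (Suc q) = excess q + int (card {w \<in> right_special. length w = q}) - 1"
proof -
  define A where "A a = {w. w @ [a] \<in> L \<and> length w = q}" for a
  have sub: "A a \<subseteq> {w \<in> L. length w = q}" for a
  proof
    fix w assume "w \<in> A a"
    then show "w \<in> {w \<in> L. length w = q}"
      using factorial[of "w @ [a]" w] by (auto simp: A_def)
  qed
  have fin: "finite (A a)" for a
    using finite_subset[OF sub finite_words] .
  have "{w \<in> L. length w = Suc q} = (\<lambda>w. w @ [0]) ` A 0 \<union> (\<lambda>w. w @ [1]) ` A 1"
    (is "?S = ?T")
  proof
    show "?S \<subseteq> ?T"
    proof
      fix w assume w: "w \<in> ?S"
      then obtain v a where v: "w = v @ [a]" by (cases w rule: rev_cases) auto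
      with w letters[of w] have "a = 0 \<or> a = 1" by auto
      with w v show "w \<in> ?T" by (auto simp: A_def)
    qed
  qed (auto simp: A_def)
  moreover have "card (?T) = card (A 0) + card (A 1)"
    using fin by (subst card_Un_disjoint) (auto simp: card_image inj_on_def)
  moreover have "A 0 \<union> A 1 = {w \<in> L. length w = q}"
  proof
    show "{w \<in> L. length w = q} \<subseteq> A 0 \<union> A 1"
    proof
      fix w assume w: "w \<in> {w \<in> L. length w = q}"
      then obtain a where a: "w @ [a] \<in> L" using right_ext by auto
      with letters[OF a] have "a = 0 \<or> a = 1" by auto
      with w a show "w \<in> A 0 \<union> A 1" by (auto simp: A_def)
    qed
  qed (use sub in auto)
  moreover have "A 0 \<inter> A 1 = {w \<in> right_special. length w = q}"
    by (auto simp: A_def right_special_def)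
  ultimately show ?thesis
    using card_Un_Int[OF fin fin, of 0 1] by (simp add: excess_def)
qed

lemma finite_right_special: "finite {w \<in> right_special. length w = q}"
  by (rule finite_subset[OF _ finite_words[of q]]) (auto dest: right_special_in_L)

lemma excess_le_Suc: "excess q \<le> excess (Suc q)"
proof -
  obtain w where "w \<in> {w \<in> right_special. length w = q}" using special by (auto simp: right_special_def)
  then have "card {w \<in> right_special. length w = q} > 0"
    using finite_right_special card_gt_0_iff by blast
  then show ?thesis by (simp add: excess_Suc)
qed

lemma excess_mono: "m \<le> n \<Longrightarrow> excess m \<le> excess n"
  by (rule lift_Suc_mono_le[of excess]) (rule excess_le_Suc)

lemma excess_nonneg: "0 \<le> excess n"
proof -
  obtain w where "w \<in> L" using special[of 0] by blast
  then have "{w \<in> L. length w = 0} = {[]}" using factorial[of w "[]"] by auto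
  then have "excess 0 = 1" by (simp add: excess_def)
  then show ?thesis using excess_mono[of 0 n] by simp
qed

text \<open>Suffixes of right-special words are right-special. As the two words differ just before
  the common suffix \<open>t\<close>, their suffixes of each length from \<open>length t + 1\<close>
  to \<open>Q\<close> are distinct, and every such length adds at least one to the excess.\<close>

lemma excess_gain:
  assumes "u' @ x # t \<in> right_special" "v' @ y # t \<in> right_special" "x \<noteq> y"
    and "length t \<le> Q" "Q \<le> length (u' @ x # t)" "Q \<le> length (v' @ y # t)"
  shows "excess (Suc Q) \<ge> excess (Suc (length t)) + int (Q - length t)"
  using assms(4-)
proof (induction Q rule: dec_induct)
  case (step n)
  have suff: "\<exists>s'. s' @ a # t \<in> right_special \<and> length (s' @ a # t) = Suc n"
    if "s @ a # t \<in> right_special" "Suc n \<le> length (s @ a # t)" for s a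
  proof -
    \<comment> \<open>Dropping \<open>?k\<close> letters leaves exactly \<open>Suc n\<close>, the
      differing letter \<open>a\<close> among them.\<close>
    let ?k = "length s - (n - length t)"
    have eq: "take ?k s @ drop ?k s @ a # t = s @ a # t"
      by (metis append_assoc append_take_drop_id)
    have "drop ?k s @ a # t \<in> right_special"
      using right_special_suffix[of "take ?k s"] that eq by metis
    moreover have "length (drop ?k s @ a # t) = Suc n"
      using that step.hyps by auto
    ultimately show ?thesis by blast
  qed
  obtain u2 where u2: "u2 @ x # t \<in> right_special" "length (u2 @ x # t) = Suc n"
    using suff[OF assms(1)] step.prems by blast
  obtain v2 where v2: "v2 @ y # t \<in> right_special" "length (v2 @ y # t) = Suc n"
    using suff[OF assms(2)] step.prems by blast
  have "u2 @ x # t \<noteq> v2 @ y # t"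
    using assms(3) u2 v2 by auto
  then have "card {u2 @ x # t, v2 @ y # t} = 2" by simp
  moreover have "card {u2 @ x # t, v2 @ y # t} \<le> card {w \<in> right_special. length w = Suc n}"
    by (rule card_mono[OF finite_right_special]) (use u2 v2 in auto)
  ultimately have "excess (Suc (Suc n)) \<ge> excess (Suc n) + 1"
    using excess_Suc[of "Suc n"] by linarith
  moreover have "excess (Suc n) \<ge> excess (Suc (length t)) + int (n - length t)"
    by (rule step.IH) (use step.prems in auto)
  ultimately show ?case using step.hyps by auto
qed simp

end

section \<open>Languages coded by blocks and gaps\<close>

text \<open>Inclusion of the coded words in \<open>L\<close> suffices for exhibiting right-special
  words. The lower bound \<open>c\<close> together with left extension supplies \<open>c\<close>
  spacers in front of the first block.\<close>

locale gap_coding = special_lang +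
  fixes B :: "nat list" and \<Gamma> :: "nat list set" and c :: nat
  assumes B_first: "\<exists>T. B = 0 # T"
    and B_last: "\<exists>T. B = T @ [0]"
    and \<Gamma>_factorial: "gs \<in> \<Gamma> \<Longrightarrow> sublist hs gs \<Longrightarrow> hs \<in> \<Gamma>"
    and \<Gamma>_left_ext: "gs \<in> \<Gamma> \<Longrightarrow> \<exists>a. a # gs \<in> \<Gamma>"
    and \<Gamma>_min: "gs \<in> \<Gamma> \<Longrightarrow> x \<in> set gs \<Longrightarrow> c \<le> x"
    and \<Gamma>_word: "gs \<in> \<Gamma> \<Longrightarrow> block_word B gs \<in> L"
begin

text \<open>After \<open>x\<close> spacers the gap \<open>x\<close> is closed by the 0 that starts
  the next block, while the gap \<open>y\<close> continues with a 1. The padding on the left is the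
  end of the gap preceding \<open>gs\<close>, which is at least \<open>c\<close>.\<close>

lemma right_special_gap:
  assumes "gs @ [x] \<in> \<Gamma>" "gs @ [y] \<in> \<Gamma>" "x < y"
  shows "replicate c 1 @ block_word B gs @ replicate x 1 \<in> right_special"
proof -
  obtain T where T: "B = 0 # T" using B_first by blast
  have ext: "\<exists>U. U @ replicate c 1 @ block_word B gs @ replicate v 1 @ B \<in> L"
    if v: "gs @ [v] \<in> \<Gamma>" for v
  proof -
    obtain a where a: "a # gs @ [v] \<in> \<Gamma>" using \<Gamma>_left_ext[OF v] by blast
    then have "c \<le> a" using \<Gamma>_min by auto
    then have "replicate a 1 = replicate (a - c) 1 @ replicate c (1::nat)"
      by (simp flip: replicate_add)
    with \<Gamma>_word[OF a] show ?thesis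
      by (intro exI[of _ "B @ replicate (a - c) 1"]) (simp add: block_word_append)
  qed
  obtain U where U: "U @ replicate c 1 @ block_word B gs @ replicate x 1 @ B \<in> L"
    using ext assms(1) by blast
  obtain U' where U': "U' @ replicate c 1 @ block_word B gs @ replicate y 1 @ B \<in> L"
    using ext assms(2) by blast
  have y: "replicate y 1 = replicate x 1 @ 1 # replicate (y - x - 1) (1::nat)"
    using assms(3) by (metis Suc_diff_Suc add_diff_inverse_nat diff_Suc_eq_diff_pred
        not_less_iff_gr_or_eq replicate_Suc replicate_add diff_commute)
  have "(replicate c 1 @ block_word B gs @ replicate x 1) @ [0] \<in> L"
    by (rule factorial[OF U], unfold sublist_def, rule exI[of _ U], rule exI[of _ T]) (simp add: T)
  moreover have "(replicate c 1 @ block_word B gs @ replicate x 1) @ [1] \<in> L"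
    by (rule factorial[OF U'], unfold sublist_def, rule exI[of _ U'],
        rule exI[of _ "replicate (y - x - 1) 1 @ B"]) (simp add: y del: One_nat_def)
  ultimately show ?thesis unfolding right_special_def by blast
qed

end

text \<open>The combinatorial core of the coarsening step: \<open>y\<close> closes a run of \<open>z\<close> on either side of \<open>u\<close>,
  and a run of length \<open>2 m + 1\<close> is split as two runs of length \<open>m\<close> joined by the gap \<open>z\<close>.\<close>

lemma join_word_of_runs:
  assumes "\<And>k. sublist (y # replicate k z @ [y]) (y # u @ [y]) \<Longrightarrow> k = m \<or> k = 2 * m + 1"
    and "set u \<subseteq> {y, z}"
  shows "\<exists>vs. set vs \<subseteq> {y, z} \<and> u = join_word (replicate m z) vs"
  using assms
proof (induction "length u" arbitrary: u rule: less_induct)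
  case less
  have step: "\<exists>vs. set vs \<subseteq> {y, z} \<and> replicate k z = join_word (replicate m z) vs"
    if k: "sublist (y # replicate k z @ [y]) (y # u @ [y])" for k
  proof -
    consider "k = m" | "k = 2 * m + 1" using less.prems(1)[OF k] by blast
    then show ?thesis
    proof cases
      case 1 then show ?thesis by (intro exI[of _ "[]"]) auto
    next
      case 2
      have "replicate k z = replicate m z @ z # replicate m z"
        unfolding 2 by (simp add: mult_2 replicate_add replicate_app_Cons_same)
      then show ?thesis by (intro exI[of _ "[z]"]) auto
    qed
  qed
  show ?case
  proof (cases "y \<in> set u")
    case False
    then have u: "u = replicate (length u) z"
      using less.prems(2) by (intro replicate_eqI) auto
    show ?thesis using step[of "length u"] u by auto
  next
    case True
    then obtain ys zs where u: "u = ys @ y # zs" "y \<notin> set ys"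
      using split_list_first by metis
    have ys: "ys = replicate (length ys) z"
      using less.prems(2) u by (intro replicate_eqI) auto
    \<comment> \<open>The letter \<open>y\<close> placed in front of \<open>u\<close> makes the
      first run a complete run, enclosed by \<open>y\<close> on both sides.\<close>
    have "sublist (y # ys @ [y]) (y # u @ [y])"
      using u by (auto simp: sublist_def)
    then obtain vs where vs: "set vs \<subseteq> {y, z}" "ys = join_word (replicate m z) vs"
      using step[of "length ys"] ys by metis
    have "\<exists>vs. set vs \<subseteq> {y, z} \<and> zs = join_word (replicate m z) vs"
    proof (rule less.hyps)
      fix k assume "sublist (y # replicate k z @ [y]) (y # zs @ [y])"
      moreover have "sublist (y # zs @ [y]) (y # u @ [y])"
        using u unfolding sublist_def by (metis append_Cons append_Nil2 append_assoc)
      ultimately show "k = m \<or> k = 2 * m + 1"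
        using less.prems(1) sublist_order.order.trans by blast
    qed (use u less.prems in auto)
    then obtain vs' where vs': "set vs' \<subseteq> {y, z}" "zs = join_word (replicate m z) vs'"
      by blast
    show ?thesis
      by (rule exI[of _ "vs @ y # vs'"])
        (use vs vs' u in \<open>auto simp: join_word_append\<close>)
  qed
qed

section \<open>Intervals of growth for gap languages over two letters\<close>

locale binary_coding = gap_coding +
  fixes d :: nat and V :: "nat list"
  assumes c_less_d: "c < d"
    and \<Gamma>_binary: "gs \<in> \<Gamma> \<Longrightarrow> set gs \<subseteq> {c, d}"
    and set_V: "set V = {c, d}"
    and V_join: "x \<in> {c, d} \<Longrightarrow> V @ x # V \<in> \<Gamma>"
begin

text \<open>All gaps are at least \<open>c\<close>, so \<open>1^c\<close> can be added for free on both sides of a coded word; with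
  this padding a gap word is right-special as soon as it can be continued by both gaps.\<close>

definition padded :: "nat list \<Rightarrow> nat list" where
  "padded gs = replicate c 1 @ block_word B gs @ replicate c 1"

lemma length_padded: "length (padded gs) = 2 * c + length B + (\<Sum>g\<leftarrow>gs. length B + g)"
  by (simp add: padded_def length_block_word)

lemma length_padded_replicate:
  "length (padded (replicate k z)) = 2 * c + length B + k * (length B + z)"
  by (simp add: length_padded sum_list_replicate map_replicate)

lemma padded_right_special:
  assumes "gs @ [x] \<in> \<Gamma>" "gs @ [y] \<in> \<Gamma>" "x \<noteq> y"
  shows "padded gs \<in> right_special"
proof -
  have "{x, y} \<subseteq> {c, d}" using \<Gamma>_binary[OF assms(1)] \<Gamma>_binary[OF assms(2)] by auto
  with assms have "gs @ [c] \<in> \<Gamma>" "gs @ [d] \<in> \<Gamma>" by auto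
  then show ?thesis unfolding padded_def by (intro right_special_gap[OF _ _ c_less_d])
qed

text \<open>In front of the last \<open>c\<close> spacers of a gap stands the final 0 of the
  preceding block if the gap is \<open>c\<close>, and a surplus spacer if it is \<open>d\<close>. So
  gap words that differ in one gap yield words that differ in the letter just before the common
  padded suffix.\<close>

lemma padded_split:
  assumes "x \<in> {c, d}"
  shows "\<exists>A. padded (us @ x # ws) = A @ (if x = c then 0 else 1) # padded ws"
proof (cases "x = c")
  case True
  obtain T where "block_word B us = T @ [0]" using B_last block_word_last by blast
  then show ?thesis using True by (auto simp: padded_def block_word_append)
next
  case False
  have "replicate d 1 = replicate (d - Suc c) 1 @ 1 # replicate c (1::nat)"
    using c_less_d by (simp flip: replicate_Suc replicate_add)
  then show ?thesis using False assms
    by (intro exI[of _ "replicate c 1 @ block_word B us @ replicate (d - Suc c) 1"])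
      (auto simp: padded_def block_word_append)
qed

lemma padded_gain:
  assumes "padded (us @ x # ws) \<in> right_special" "padded (us' @ y # ws) \<in> right_special"
    and "x \<in> {c, d}" "y \<in> {c, d}" "x \<noteq> y"
    and "length (padded ws) \<le> Q"
    and "Q \<le> length (padded (us @ x # ws))" "Q \<le> length (padded (us' @ y # ws))"
  shows "excess (Suc Q) \<ge> excess (Suc (length (padded ws))) + int (Q - length (padded ws))"
proof -
  obtain A where A: "padded (us @ x # ws) = A @ (if x = c then 0 else 1) # padded ws"
    using padded_split assms by blast
  obtain A' where A': "padded (us' @ y # ws) = A' @ (if y = c then 0 else 1) # padded ws"
    using padded_split assms by blast
  show ?thesis
  proof (rule excess_gain)
    show "A @ (if x = c then 0 else 1) # padded ws \<in> right_special" using assms A by simp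
    show "A' @ (if y = c then 0 else 1) # padded ws \<in> right_special" using assms A' by simp
    show "Q \<le> length (A @ (if x = c then 0 else 1) # padded ws)" using assms A by metis
    show "Q \<le> length (A' @ (if y = c then 0 else 1) # padded ws)" using assms A' by metis
  qed (use assms in auto)
qed

text \<open>The left-hand length in \<open>doubling\<close> is, up to a constant, at most twice the gain; in \<open>coarsening\<close> it exceeds
  twice the gain by one block, which is made up for by the preceding coarsening step.\<close>

definition doubling :: bool where
  "doubling \<longleftrightarrow> (\<exists>k z. z \<in> {c, d} \<and>
     excess (Suc (2 * c + 2 * length B + 2 * (k * (length B + z))))
     \<ge> excess (Suc (2 * c + length B + k * (length B + z))) + int (k * (length B + z) + length B))"

definition coarsening :: bool where
  "coarsening \<longleftrightarrow> (\<exists>k z vs. z \<in> {c, d} \<and> k \<ge> 1 \<and> set vs \<subseteq> {c, d} \<and>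
     V = join_word (replicate k z) vs \<and>
     excess (Suc (2 * c + length B + 2 * (k * (length B + z))))
     \<ge> excess (Suc (2 * c + length B + k * (length B + z))) + int (k * (length B + z)))"

lemma V_first_run:
  assumes "{y, z} = {c, d}" "y \<noteq> z"
  obtains i P where "V = replicate i z @ y # P"
proof -
  have "y \<in> set V" using set_V assms by auto
  then obtain ys zs where u: "V = ys @ y # zs" "y \<notin> set ys"
    using split_list_first by metis
  have "set V = {y, z}" using set_V assms by auto
  then have "ys = replicate (length ys) z"
    using u by (intro replicate_eqI) auto
  then show ?thesis using that u by metis
qed

lemma V_last_run:
  assumes "{y, z} = {c, d}" "y \<noteq> z"
  obtains j P where "V = P @ y # replicate j z"
proof -
  have "y \<in> set V" using set_V assms by auto
  then obtain ys zs where u: "V = ys @ y # zs" "y \<notin> set zs"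
    using split_list_last by metis
  have "set V = {y, z}" using set_V assms by auto
  then have "zs = replicate (length zs) z"
    using u by (intro replicate_eqI) auto
  then show ?thesis using that u by metis
qed

text \<open>Let \<open>m\<close> be the length of the shortest run of \<open>z\<close> enclosed by
  \<open>y\<close>. The word \<open>z^m y z^m\<close> is right-special; it is compared with a
  right-special word ending in \<open>z^(m+1)\<close>, whose available length depends on which other
  run lengths occur.\<close>

lemma isolated_step:
  assumes yz: "{y, z} = {c, d}" "y \<noteq> z" and iso: "[y, y] \<notin> \<Gamma>"
  shows "doubling \<or> coarsening"
proof -
  obtain i P where P: "V = replicate i z @ y # P" by (rule V_first_run[OF yz])
  obtain j P' where P': "V = P' @ y # replicate j z" by (rule V_last_run[OF yz])
  have mem: "y \<in> {c, d}" "z \<in> {c, d}" using yz by auto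
  define R where "R k \<longleftrightarrow> y # replicate k z @ [y] \<in> \<Gamma>" for k
  have Vy: "V @ y # V \<in> \<Gamma>" and Vz: "V @ z # V \<in> \<Gamma>" using V_join mem by auto
  \<comment> \<open>Joining two copies of \<open>V\<close> by \<open>y\<close> completes the first
    run \<open>i\<close> and the last run \<open>j\<close> of \<open>V\<close>; joining them by
    \<open>z\<close> merges these into a run of length \<open>i + j + 1\<close>, which exceeds
    \<open>2 * m\<close>.\<close>
  have "V @ y # V = (replicate i z @ y # P) @ y # (replicate i z @ y # P)" using P by simp
  then have "sublist (y # replicate i z @ [y]) (V @ y # V)"
    unfolding sublist_def by (metis append_Cons append_Nil append_assoc)
  then have Ri: "R i" unfolding R_def by (rule \<Gamma>_factorial[OF Vy])
  have "V @ y # V = P' @ (y # replicate j z @ [y]) @ V" by (subst P') simp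
  then have "sublist (y # replicate j z @ [y]) (V @ y # V)"
    unfolding sublist_def by blast
  then have Rj: "R j" unfolding R_def by (rule \<Gamma>_factorial[OF Vy])
  have "V @ z # V = (P' @ y # replicate j z) @ z # (replicate i z @ y # P)"
    using P P' by simp
  also have "\<dots> = P' @ (y # replicate (i + j + 1) z @ [y]) @ P"
    by (simp add: replicate_add replicate_app_Cons_same add.commute)
      (metis replicate_add add.commute append_assoc)
  finally have "sublist (y # replicate (i + j + 1) z @ [y]) (V @ z # V)"
    unfolding sublist_def by blast
  then have Rij: "R (i + j + 1)" unfolding R_def by (rule \<Gamma>_factorial[OF Vz])
  define m where "m = (LEAST k. R k)"
  have Rm: "R m" unfolding m_def using Ri by (rule LeastI)
  have m_le: "m \<le> k" if "R k" for k unfolding m_def using that by (rule Least_le)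
  have "\<not> R 0" using iso by (simp add: R_def)
  then have m_pos: "m \<ge> 1" using Rm by (cases m) auto
  have m_ij: "m \<le> i" "m \<le> j" using m_le Ri Rj by auto
  \<comment> \<open>Fewer than \<open>m\<close> letters \<open>z\<close> before a \<open>y\<close>
    cannot be preceded by \<open>y\<close>, as this would be an enclosed run shorter than
    \<open>m\<close>. So left extension must add \<open>z\<close>.\<close>
  have left: "replicate t z @ y # u \<in> \<Gamma>" if u: "y # u \<in> \<Gamma>" and t: "t \<le> m" for t u
    using t
  proof (induction t)
    case (Suc t)
    then obtain a where a: "a # replicate t z @ y # u \<in> \<Gamma>" using \<Gamma>_left_ext by fastforce
    have "a \<noteq> y"
    proof
      assume "a = y"
      then have "sublist (y # replicate t z @ [y]) (a # replicate t z @ y # u)"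
        unfolding sublist_def by (intro exI[of _ "[]"] exI[of _ u]) auto
      then have "R t" unfolding R_def by (rule \<Gamma>_factorial[OF a])
      then show False using m_le Suc.prems by fastforce
    qed
    moreover have "a \<in> {c, d}" using \<Gamma>_binary[OF a] by auto
    ultimately have "a = z" using yz by auto
    then show ?case using a by simp
  qed (use u in simp)
  have rep: "y # replicate k z @ [z] \<in> \<Gamma>" if "R K" "k < K" for k K
  proof -
    have "replicate K z = replicate k z @ z # replicate (K - k - 1) z"
      using that(2) by (simp flip: replicate_Suc replicate_add)
    then have "sublist (y # replicate k z @ [z]) (y # replicate K z @ [y])"
      unfolding sublist_def
      by (intro exI[of _ "[]"] exI[of _ "replicate (K - k - 1) z @ [y]"]) simp
    then show ?thesis using that(1) unfolding R_def by (rule \<Gamma>_factorial[rotated])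
  qed
  \<comment> \<open>The run \<open>z^k\<close> can be closed by \<open>y\<close>, and it can go on
    with \<open>z\<close> inside the longer run \<open>z^K\<close>.\<close>
  have RS1: "padded (replicate m z @ y # replicate k z) \<in> right_special" if "R k" "R K" "k < K" for k K
  proof -
    have "replicate m z @ y # replicate k z @ [z] \<in> \<Gamma>"
      using left rep that by auto
    moreover have "replicate m z @ y # replicate k z @ [y] \<in> \<Gamma>"
      using left that unfolding R_def by auto
    ultimately show ?thesis using yz by (intro padded_right_special[of _ z y]) auto
  qed
  have RS2: "padded (replicate k z) \<in> right_special" if RK: "R K" and k: "k < K" for k K
  proof (rule padded_right_special[of _ z y])
    show "replicate k z @ [z] \<in> \<Gamma>"
      using rep[OF RK k] by (rule \<Gamma>_factorial) (auto simp: sublist_def intro: exI[of _ "[y]"])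
    have "replicate K z = replicate (K - k) z @ replicate k z"
      using k by (simp flip: replicate_add)
    then have "sublist (replicate k z @ [y]) (y # replicate K z @ [y])"
      unfolding sublist_def
      by (intro exI[of _ "y # replicate (K - k) z"] exI[of _ "[]"]) simp
    then show "replicate k z @ [y] \<in> \<Gamma>"
      using RK unfolding R_def by (rule \<Gamma>_factorial[rotated])
  qed (use yz in auto)
  let ?h = "length B"
  let ?D = "2 * c + ?h + m * (?h + z)"
  have D: "length (padded (replicate m z)) = ?D" by (rule length_padded_replicate)
  have right_special_m: "padded (replicate m z @ y # replicate m z) \<in> right_special"
    by (rule RS1[OF Rm Rij]) (use m_ij in simp)
  have len_m: "length (padded (replicate m z @ y # replicate m z))
      = 2 * c + 2 * ?h + 2 * (m * (?h + z)) + y"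
    by (simp add: length_padded sum_list_replicate map_replicate)
  \<comment> \<open>Both words end in \<open>z^m\<close>; it is preceded by \<open>z\<close> in one
    and by \<open>y\<close> in the other.\<close>
  have gain: "excess (Suc Q) \<ge> excess (Suc ?D) + int (Q - ?D)"
    if "padded (us @ z # replicate m z) \<in> right_special" "?D \<le> Q"
      "Q \<le> length (padded (us @ z # replicate m z))"
      "Q \<le> 2 * c + 2 * ?h + 2 * (m * (?h + z))" for us Q
    using padded_gain[OF that(1) right_special_m, of Q] that mem yz unfolding D len_m by auto
  have extend: "replicate k z = replicate (k - m - 1) z @ z # replicate m z" if "m < k" for k
    using that by (simp flip: replicate_Suc replicate_add)
  \<comment> \<open>In the first case \<open>z^m y z^k\<close> and in the second
    \<open>z^(2m+1)\<close> is long enough for doubling. In the third only \<open>z^(2m)\<close> is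
    used, which is one block short; in return all runs have length \<open>m\<close> or
    \<open>2 m + 1\<close>.\<close>
  consider (mid) k where "R k" "m < k" "k \<le> 2 * m"
    | (long) k where "R k" "2 * m + 2 \<le> k"
    | (two) "\<And>k. R k \<Longrightarrow> k = m \<or> k = 2 * m + 1"
    using m_le by (metis Suc_leI le_antisym not_less not_less_eq_eq Suc_eq_plus1 add_2_eq_Suc')
  then show ?thesis
  proof cases
    case mid
    let ?us = "replicate m z @ y # replicate (k - m - 1) z"
    let ?Q = "2 * c + 2 * ?h + 2 * (m * (?h + z))"
    have eq: "?us @ z # replicate m z = replicate m z @ y # replicate k z"
      using extend[OF mid(2)] by simp
    have rs: "padded (?us @ z # replicate m z) \<in> right_special"
      unfolding eq by (rule RS1[OF mid(1) Rij]) (use mid m_ij in simp)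
    have "length (padded (?us @ z # replicate m z))
        = 2 * c + 2 * ?h + m * (?h + z) + k * (?h + z) + y"
      unfolding eq by (simp add: length_padded sum_list_replicate map_replicate)
    moreover have "m * (?h + z) \<le> k * (?h + z)" using mid by (intro mult_right_mono) auto
    ultimately have "?Q \<le> length (padded (?us @ z # replicate m z))"
      by linarith
    with rs have "excess (Suc ?Q) \<ge> excess (Suc ?D) + int (?Q - ?D)"
      by (intro gain[of ?us]) auto
    then have doubling unfolding doubling_def using mem
      by (intro exI[of _ m] exI[of _ z]) (auto simp: add.commute)
    then show ?thesis ..
  next
    case long
    let ?us = "replicate m z"
    let ?Q = "2 * c + 2 * ?h + 2 * (m * (?h + z))"
    have eq: "?us @ z # replicate m z = replicate (2 * m + 1) z"
      by (simp add: mult_2 replicate_add replicate_app_Cons_same)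
    have "padded (?us @ z # replicate m z) \<in> right_special"
      unfolding eq by (rule RS2[OF long(1)]) (use long in simp)
    moreover have "?Q \<le> length (padded (?us @ z # replicate m z))"
      unfolding eq length_padded_replicate by simp
    ultimately have "excess (Suc ?Q) \<ge> excess (Suc ?D) + int (?Q - ?D)"
      by (intro gain[of ?us]) auto
    then have doubling unfolding doubling_def using mem
      by (intro exI[of _ m] exI[of _ z]) (auto simp: add.commute)
    then show ?thesis ..
  next
    case two
    let ?us = "replicate (m - 1) z"
    let ?Q = "2 * c + ?h + 2 * (m * (?h + z))"
    have eq: "?us @ z # replicate m z = replicate (2 * m) z"
      using extend[of "2 * m"] m_pos by simp
    have "padded (?us @ z # replicate m z) \<in> right_special"
      unfolding eq by (rule RS2[OF Rij]) (use m_ij in simp)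
    moreover have "?Q \<le> length (padded (?us @ z # replicate m z))"
      unfolding eq length_padded_replicate by simp
    ultimately have gain2: "excess (Suc ?Q) \<ge> excess (Suc ?D) + int (?Q - ?D)"
      by (intro gain[of ?us]) auto
    have "\<exists>vs. set vs \<subseteq> {y, z} \<and> V = join_word (replicate m z) vs"
    proof (rule join_word_of_runs)
      fix k assume "sublist (y # replicate k z @ [y]) (y # V @ [y])"
      then obtain ps ss where ps: "y # V @ [y] = ps @ (y # replicate k z @ [y]) @ ss"
        by (auto simp: sublist_def)
      have yV: "y # V \<in> \<Gamma>" "V @ [y] \<in> \<Gamma>"
        using \<Gamma>_factorial[OF Vy] unfolding sublist_def
        by (metis append_Cons append_Nil append_Nil2 append_assoc)+
      \<comment> \<open>The occurrence cannot fill all of \<open>y V y\<close>, because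
        \<open>V\<close> contains \<open>y\<close>. Hence it lies in \<open>y V\<close> or in
        \<open>V y\<close>, and both belong to \<open>\<Gamma>\<close>.\<close>
      have "R k"
      proof (cases ps)
        case (Cons a ps')
        then have "V @ [y] = ps' @ (y # replicate k z @ [y]) @ ss" using ps by auto
        then have "sublist (y # replicate k z @ [y]) (V @ [y])" unfolding sublist_def by blast
        then show ?thesis unfolding R_def by (rule \<Gamma>_factorial[OF yV(2)])
      next
        case Nil
        show ?thesis
        proof (cases ss rule: rev_cases)
          case (snoc ss' a)
          then have "y # V = [] @ (y # replicate k z @ [y]) @ ss'" using ps Nil
            by (metis append.assoc append_Cons append_Nil butlast_snoc)
          then have "sublist (y # replicate k z @ [y]) (y # V)" unfolding sublist_def by blast
          then show ?thesis unfolding R_def by (rule \<Gamma>_factorial[OF yV(1)])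
        next
          case ss: Nil
          then have "V = replicate k z" using ps Nil by simp
          then have "y \<notin> set V" using yz by auto
          then show ?thesis using set_V mem by auto
        qed
      qed
      then show "k = m \<or> k = 2 * m + 1" by (rule two)
    qed (use set_V yz in auto)
    then obtain vs where "set vs \<subseteq> {y, z}" "V = join_word (replicate m z) vs" by blast
    then have coarsening unfolding coarsening_def using gain2 mem m_pos yz
      by (intro exI[of _ m] exI[of _ z] exI[of _ vs]) (auto simp: add.commute)
    then show ?thesis ..
  qed
qed

text \<open>The last \<open>y\<close> of \<open>V\<close> is followed in \<open>V z V\<close> either
  by a \<open>z\<close> of the last run of \<open>V\<close> or by the joining
  \<open>z\<close>.\<close>

lemma transition:
  assumes yz: "{y, z} = {c, d}" "y \<noteq> z"
  shows "[y, z] \<in> \<Gamma>"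
proof -
  obtain j P where P: "V = P @ y # replicate j z" by (rule V_last_run[OF yz])
  have "V @ z # V = P @ [y, z] @ replicate j z @ V"
    by (subst P) (simp add: replicate_app_Cons_same)
  then have "sublist [y, z] (V @ z # V)" unfolding sublist_def by blast
  moreover have "z \<in> {c, d}" using yz by auto
  ultimately show ?thesis using \<Gamma>_factorial[OF V_join[of z]] by auto
qed

text \<open>If both letters can be repeated, all four pairs occur, so the one-letter gap words
  \<open>c\<close> and \<open>d\<close> are right-special and doubling holds with
  \<open>k = 0\<close>. Otherwise one letter is isolated.\<close>

lemma doubling_or_coarsening: "doubling \<or> coarsening"
proof (cases "[c, c] \<in> \<Gamma> \<and> [d, d] \<in> \<Gamma>")
  case True
  have t: "[c, d] \<in> \<Gamma>" "[d, c] \<in> \<Gamma>" using transition c_less_d by auto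
  have "padded ([] @ c # []) \<in> right_special" "padded ([] @ d # []) \<in> right_special"
    using True t c_less_d padded_right_special[of "[c]" c d] padded_right_special[of "[d]" c d] by auto
  then have "excess (Suc (2 * c + 2 * length B)) \<ge> excess (Suc (length (padded [])))
      + int (2 * c + 2 * length B - length (padded []))"
    by (rule padded_gain) (use c_less_d in \<open>auto simp: length_padded\<close>)
  then have doubling unfolding doubling_def
    by (intro exI[of _ 0] exI[of _ c]) (auto simp: length_padded)
  then show ?thesis ..
next
  case False
  then show ?thesis
    using isolated_step[of c d] isolated_step[of d c] c_less_d by (auto simp: insert_commute)
qed

end

section \<open>Gap sequences of rank-one words\<close>

locale gap_sequence =
  fixes g :: "nat \<Rightarrow> nat list"
  assumes g_nonempty: "g n \<noteq> []"
begin

primrec b :: "nat \<Rightarrow> nat list" where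
  "b 0 = [0]"
| "b (Suc n) = block_word (b n) (g n)"

primrec gaps_between :: "nat \<Rightarrow> nat \<Rightarrow> nat list" where
  "gaps_between n 0 = []"
| "gaps_between n (Suc k) = join_word (gaps_between n k) (g (n + k))"

text \<open>\<open>\<Lambda> n\<close> is the language of gap sequences between copies of \<open>b n\<close>, and
  \<open>\<Gamma>\<^sub>V V n\<close> below the one between copies of \<open>B\<close> when \<open>b n\<close> is \<open>B\<close> with gap sequence \<open>V\<close>.\<close>

definition \<Lambda> :: "nat \<Rightarrow> nat list set" where
  "\<Lambda> n = {hs. \<exists>k. sublist hs (gaps_between n k)}"

definition gap_set :: "nat \<Rightarrow> nat set" where
  "gap_set n = (\<Union>m\<in>{n..}. set (g m))"

definition L :: "nat list set" where
  "L = {w. \<exists>n. sublist w (b n)}"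

lemma b_add: "b (n + k) = block_word (b n) (gaps_between n k)"
  by (induction k) (auto simp: block_word_join_word)

lemma b_first: "\<exists>T. b n = 0 # T"
proof (induction n)
  case (Suc n)
  then show ?case using block_word_first[of "b n"] by auto
qed simp

lemma b_last: "\<exists>T. b n = T @ [0]"
proof (induction n)
  case (Suc n)
  then show ?case using block_word_last[of "b n"] by auto
qed simp

lemma set_b: "set (b n) \<subseteq> {0, 1}"
proof (induction n)
  case (Suc n)
  have "set (block_word (b n) gs) \<subseteq> {0, 1}" for gs
    by (induction gs) (use Suc in auto)
  then show ?case by simp
qed simp

text \<open>Since \<open>b n\<close> is a proper prefix and a proper suffix of
  \<open>b (Suc n)\<close>, every word of \<open>L\<close> can be extended on both sides.\<close>

lemma b_Suc_decomp: "\<exists>x T U. b (Suc n) = b n @ replicate x 1 @ 0 # T \<and> b (Suc n) = U @ b n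
    \<and> U \<noteq> []"
proof -
  obtain x hs where g: "g n = x # hs" using g_nonempty[of n] by (cases "g n") auto
  obtain T0 where T0: "b n = 0 # T0" using b_first by blast
  obtain T where T: "block_word (b n) hs = 0 # T"
    using block_word_first[OF T0] by blast
  obtain hs' x' where g': "g n = hs' @ [x']" using g_nonempty[of n] by (cases "g n" rule: rev_cases) auto
  obtain T' where T': "b n = T' @ [0]" using b_last by blast
  have "b (Suc n) = block_word (b n) hs' @ replicate x' 1 @ b n"
    by (simp add: g' block_word_append)
  moreover have "block_word (b n) hs' \<noteq> []"
    using block_word_first[OF T0, of hs'] by auto
  ultimately show ?thesis using T g
    by (intro exI[of _ x] exI[of _ T] exI[of _ "block_word (b n) hs' @ replicate x' 1"]) simp
qed

lemma L_factorial: "w \<in> L \<Longrightarrow> sublist u w \<Longrightarrow> u \<in> L"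
  unfolding L_def using sublist_order.order.trans by blast

lemma L_letters: "w \<in> L \<Longrightarrow> set w \<subseteq> {0, 1}"
  unfolding L_def using set_b set_mono_sublist by blast

lemma L_right_ext:
  assumes "w \<in> L" shows "\<exists>a. w @ [a] \<in> L"
proof -
  obtain n ps ss where ps: "b n = ps @ w @ ss" using assms by (auto simp: L_def sublist_def)
  obtain x T where "b (Suc n) = b n @ replicate x 1 @ 0 # T" using b_Suc_decomp by blast
  then obtain S where "b (Suc n) = ps @ w @ S" "S \<noteq> []" using ps by auto
  then obtain a S' where "b (Suc n) = ps @ (w @ [a]) @ S'" by (cases S) auto
  then show ?thesis unfolding L_def sublist_def by blast
qed

lemma L_left_ext:
  assumes "w \<in> L" shows "\<exists>a. a # w \<in> L"
proof -
  obtain n ps ss where ps: "b n = ps @ w @ ss" using assms by (auto simp: L_def sublist_def)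
  obtain U where "b (Suc n) = U @ b n" "U \<noteq> []" using b_Suc_decomp by metis
  then obtain S where "b (Suc n) = S @ w @ ss" "S \<noteq> []" using ps by auto
  then obtain a S' where "b (Suc n) = S' @ (a # w) @ ss" by (cases S rule: rev_cases) auto
  then show ?thesis unfolding L_def sublist_def by blast
qed

lemma set_gaps_between: "set (gaps_between n k) = (\<Union>m\<in>{n..<n + k}. set (g m))"
  by (induction k) (auto simp: set_join_word atLeastLessThanSuc)

lemma set_gaps_between_gap_set: "set (gaps_between n k) \<subseteq> gap_set n"
  by (auto simp: set_gaps_between gap_set_def)

lemma gap_set_mono: "m \<le> n \<Longrightarrow> gap_set n \<subseteq> gap_set m"
  unfolding gap_set_def by (intro UN_mono) auto

lemma gap_set_nonempty: "gap_set n \<noteq> {}"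
  using g_nonempty[of n] by (auto simp: gap_set_def intro!: bexI[of _ n])

lemma \<Lambda>_factorial: "hs \<in> \<Lambda> n \<Longrightarrow> sublist hs' hs \<Longrightarrow> hs' \<in> \<Lambda> n"
  unfolding \<Lambda>_def using sublist_order.order.trans by blast

lemma \<Lambda>_gap_set: "hs \<in> \<Lambda> n \<Longrightarrow> set hs \<subseteq> gap_set n"
  unfolding \<Lambda>_def using set_gaps_between_gap_set set_mono_sublist by blast

lemma singleton_\<Lambda>:
  assumes "x \<in> gap_set n" shows "[x] \<in> \<Lambda> n"
proof -
  obtain m where "m \<ge> n" "x \<in> set (g m)" using assms by (auto simp: gap_set_def)
  then have "x \<in> set (gaps_between n (Suc (m - n)))" unfolding set_gaps_between by auto
  then obtain ps ss where "gaps_between n (Suc (m - n)) = ps @ [x] @ ss"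
    by (auto dest!: split_list simp del: gaps_between.simps)
  then show ?thesis unfolding \<Lambda>_def sublist_def by blast
qed

text \<open>The next stage contains the old gap sequence twice with a gap \<open>h\<close> between;
  in the second copy \<open>hs\<close> has a letter on its left, at worst \<open>h\<close>
  itself.\<close>

lemma \<Lambda>_left_ext:
  assumes "hs \<in> \<Lambda> n" shows "\<exists>a. a # hs \<in> \<Lambda> n"
proof -
  obtain k ps ss where ps: "gaps_between n k = ps @ hs @ ss"
    using assms by (auto simp: \<Lambda>_def sublist_def)
  obtain h hs' where g: "g (n + k) = h # hs'" using g_nonempty by (metis neq_Nil_conv)
  let ?U = "gaps_between n k"
  have "prefix ?U (join_word ?U hs')" using prefix_join_word_append[of ?U "[]" hs'] by simp
  then obtain S where S: "join_word ?U hs' = ?U @ S" by (auto simp: prefix_def)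
  obtain S1 a where a: "?U @ h # ps = S1 @ [a]"
    by (cases "?U @ h # ps" rule: rev_cases) auto
  have "gaps_between n (Suc k) = (?U @ h # ps) @ hs @ ss @ S"
    unfolding gaps_between.simps g join_word_Cons S by (simp add: ps)
  also have "\<dots> = S1 @ (a # hs) @ ss @ S" unfolding a by simp
  finally show ?thesis unfolding \<Lambda>_def sublist_def by blast
qed

lemma block_word_\<Lambda>: "hs \<in> \<Lambda> n \<Longrightarrow> block_word (b n) hs \<in> L"
  unfolding \<Lambda>_def L_def mem_Collect_eq using sublist_block_word[of hs _ "b n"] b_add[of n] by metis

lemma length_b: "length (b n) > n"
proof (induction n)
  case (Suc n)
  obtain U where "b (Suc n) = U @ b n" "U \<noteq> []" using b_Suc_decomp by metis
  then show ?case using Suc by (cases U) auto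
qed simp

definition \<Gamma>\<^sub>V :: "nat list \<Rightarrow> nat \<Rightarrow> nat list set" where
  "\<Gamma>\<^sub>V V n = {gs. \<exists>hs\<in>\<Lambda> n. sublist gs (join_word V hs)}"

lemma \<Gamma>\<^sub>V_left_ext:
  assumes "gs \<in> \<Gamma>\<^sub>V V n" shows "\<exists>a. a # gs \<in> \<Gamma>\<^sub>V V n"
proof -
  obtain hs ps ss where hs: "hs \<in> \<Lambda> n" "join_word V hs = ps @ gs @ ss"
    using assms by (auto simp: \<Gamma>\<^sub>V_def sublist_def)
  obtain h where h: "h # hs \<in> \<Lambda> n" using \<Lambda>_left_ext hs by blast
  have "join_word V (h # hs) = (V @ h # ps) @ gs @ ss" using hs by simp
  moreover obtain S a where "V @ h # ps = S @ [a]" by (metis append_is_Nil_conv list.distinct(1) rev_exhaust)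
  ultimately have "join_word V (h # hs) = S @ (a # gs) @ ss" by simp
  then show ?thesis using h unfolding \<Gamma>\<^sub>V_def sublist_def by blast
qed

end

section \<open>Growth of the excess when at least two gaps occur at every stage\<close>

locale aperiodic_gaps = gap_sequence +
  assumes two_gaps: "gap_set n \<noteq> {x}"
begin

lemma min_gap:
  obtains c y where "c \<in> gap_set n" "y \<in> gap_set n" "c < y" "\<And>x. x \<in> gap_set n \<Longrightarrow> c \<le> x"
proof -
  define c where "c = (LEAST x. x \<in> gap_set n)"
  have c: "c \<in> gap_set n" unfolding c_def using gap_set_nonempty[of n] LeastI_ex[of "\<lambda>x. x \<in> gap_set n"] by blast
  have le: "c \<le> x" if "x \<in> gap_set n" for x unfolding c_def using that by (rule Least_le)
  obtain y where "y \<in> gap_set n" "y \<noteq> c" using two_gaps[of n c] c by blast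
  then show ?thesis using that[of c y] c le by fastforce
qed

text \<open>For gaps \<open>c < y\<close> the word \<open>b q 1^c\<close> is right-special and
  longer than \<open>q\<close>, so its suffix of length \<open>q\<close> serves.\<close>

lemma right_special_exists: "\<exists>w. length w = q \<and> w @ [0] \<in> L \<and> w @ [1] \<in> L"
proof -
  obtain c y where cy: "c \<in> gap_set q" "y \<in> gap_set q" "c < y" by (rule min_gap)
  obtain T where T: "b q = 0 # T" using b_first by blast
  let ?u = "b q @ replicate c 1"
  have c: "b q @ replicate c 1 @ b q \<in> L"
    using block_word_\<Lambda>[OF singleton_\<Lambda>[OF cy(1)]] by simp
  have u0: "?u @ [0] \<in> L"
    by (rule L_factorial[OF c], unfold sublist_def, rule exI[of _ "[]"], rule exI[of _ T]) (simp add: T)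
  have y: "b q @ replicate y 1 @ b q \<in> L"
    using block_word_\<Lambda>[OF singleton_\<Lambda>[OF cy(2)]] by simp
  have "replicate y 1 = replicate c 1 @ 1 # replicate (y - Suc c) (1::nat)"
    using cy by (simp flip: replicate_Suc replicate_add)
  then have u1: "?u @ [1] \<in> L"
    by (intro L_factorial[OF y], unfold sublist_def, intro exI[of _ "[]"]
      exI[of _ "replicate (y - Suc c) 1 @ b q"]) (simp del: One_nat_def)
  let ?k = "length ?u - q"
  have "drop ?k ?u @ [x] \<in> L" if "?u @ [x] \<in> L" for x
    by (rule L_factorial[OF that]) (metis append_assoc append_take_drop_id sublist_appendI append_Nil2)
  moreover have "length (drop ?k ?u) = q" using length_b[of q] by simp
  ultimately show ?thesis using u0 u1 by blast
qed

sublocale special_lang L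
  by unfold_locales (fact L_factorial L_letters L_right_ext right_special_exists)+

text \<open>With \<open>c\<close> the minimal gap, \<open>1^c b_n 1^c\<close> can be continued by
  the gaps \<open>c\<close> and \<open>y\<close>, and \<open>1^c b_n 1^y\<close> by \<open>y\<close>
  and \<open>z\<close>; before the common suffix \<open>1^c\<close> stand 0 and 1. At
  \<open>q = 2 * c + length (b n) + 1\<close> this gives \<open>2 * excess q - q\<close> at least
  \<open>length (b n) - 1\<close>.\<close>

lemma three_gaps:
  assumes "x \<in> gap_set n" "y \<in> gap_set n" "z \<in> gap_set n" "x < y" "y < z"
  shows "\<exists>c. excess (Suc (2 * c + length (b n))) \<ge> int (c + length (b n))"
proof -
  obtain c y' where c: "c \<in> gap_set n" "y' \<in> gap_set n" "c < y'" "\<And>x. x \<in> gap_set n \<Longrightarrow> c \<le> x"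
    using min_gap[of n] by metis
  have "c < y" using c(4)[OF assms(1)] assms by simp
  interpret gap_coding L "b n" "\<Lambda> n" c
  proof
    fix gs x assume "gs \<in> \<Lambda> n" "x \<in> set gs"
    then show "c \<le> x" using c(4) \<Lambda>_gap_set by blast
  qed (use b_first b_last \<Lambda>_factorial \<Lambda>_left_ext block_word_\<Lambda> in auto)
  have "[x'] \<in> \<Lambda> n" if "x' \<in> gap_set n" for x' using singleton_\<Lambda> that .
  then have u: "replicate c 1 @ b n @ replicate c 1 \<in> right_special" and
    v: "replicate c 1 @ b n @ replicate y 1 \<in> right_special"
    using right_special_gap[of "[]" c y] right_special_gap[of "[]" y z] c(1) assms \<open>c < y\<close> by auto
  obtain T where T: "b n = T @ [0]" using b_last by blast
  have "replicate y 1 = replicate (y - Suc c) 1 @ 1 # replicate c (1::nat)"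
    using \<open>c < y\<close> by (simp flip: replicate_Suc replicate_add)
  then have v': "replicate c 1 @ b n @ replicate y 1
      = (replicate c 1 @ b n @ replicate (y - Suc c) 1) @ 1 # replicate c 1"
    by (simp del: One_nat_def)
  have u': "replicate c 1 @ b n @ replicate c 1 = (replicate c 1 @ T) @ 0 # replicate c 1"
    by (simp add: T)
  have lu: "length ((replicate c 1 @ T) @ 0 # replicate c (1::nat)) = 2 * c + length (b n)"
    unfolding u'[symmetric] by simp
  have lv: "length ((replicate c 1 @ b n @ replicate (y - Suc c) 1) @ 1 # replicate c (1::nat))
      = c + length (b n) + y"
    unfolding v'[symmetric] by simp
  have "excess (Suc (2 * c + length (b n))) \<ge> excess (Suc (length (replicate c (1::nat))))
      + int (2 * c + length (b n) - length (replicate c (1::nat)))"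
    using u[unfolded u'] v[unfolded v']
    by (rule excess_gain) (use \<open>c < y\<close> lu lv in \<open>auto simp del: One_nat_def\<close>)
  moreover have "excess (Suc (length (replicate c (1::nat)))) \<ge> 0" by (rule excess_nonneg)
  ultimately show ?thesis by (intro exI[of _ c]) simp
qed

text \<open>The block \<open>B\<close> need not be one of the words \<open>b n\<close>, so that
  merged blocks obtained from coarsening are covered too. Here \<open>V\<close> is the gap sequence
  of \<open>b N\<close> over \<open>B\<close>.\<close>

lemma binary_step:
  assumes gap_set: "\<And>n. n \<ge> n0 \<Longrightarrow> gap_set n = {c, d}" and cd: "c < d" and N: "N \<ge> n0"
    and V: "set V = {c, d}" and bN: "b N = block_word B V"
    and B: "\<exists>T. B = 0 # T" "\<exists>T. B = T @ [0]"
  shows "binary_coding L B (\<Gamma>\<^sub>V V N) c d V"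
proof unfold_locales
  show "gs \<in> \<Gamma>\<^sub>V V N \<Longrightarrow> set gs \<subseteq> {c, d}" for gs
    unfolding \<Gamma>\<^sub>V_def using \<Lambda>_gap_set[of _ N] gap_set[OF N] V set_join_word[of V] set_mono_sublist
    by blast
  then show "gs \<in> \<Gamma>\<^sub>V V N \<Longrightarrow> x \<in> set gs \<Longrightarrow> c \<le> x" for gs x
    using cd by fastforce
  show "gs \<in> \<Gamma>\<^sub>V V N \<Longrightarrow> sublist hs gs \<Longrightarrow> hs \<in> \<Gamma>\<^sub>V V N" for gs hs
    unfolding \<Gamma>\<^sub>V_def using sublist_order.order.trans by blast
  show "block_word B gs \<in> L" if "gs \<in> \<Gamma>\<^sub>V V N" for gs
  proof -
    obtain hs where hs: "hs \<in> \<Lambda> N" "sublist gs (join_word V hs)"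
      using \<open>gs \<in> \<Gamma>\<^sub>V V N\<close> by (auto simp: \<Gamma>\<^sub>V_def)
    have "sublist (block_word B gs) (block_word (b N) hs)"
      using sublist_block_word[OF hs(2), of B] by (simp add: block_word_join_word bN)
    then show ?thesis using block_word_\<Lambda>[OF hs(1)] L_factorial by blast
  qed
  show "V @ x # V \<in> \<Gamma>\<^sub>V V N" if "x \<in> {c, d}" for x
    unfolding \<Gamma>\<^sub>V_def using singleton_\<Lambda>[of x N] that gap_set[OF N]
    by (auto intro!: bexI[of _ "[x]"])
qed (use assms \<Gamma>\<^sub>V_left_ext in auto)

lemma gaps_between_full:
  assumes "\<And>n. n \<ge> n0 \<Longrightarrow> gap_set n = {c, d}" "n \<ge> n0"
  shows "\<exists>k. set (gaps_between n k) = {c, d}"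
proof -
  have "c \<in> gap_set n" "d \<in> gap_set n" using assms by auto
  then obtain m m' where m: "m \<ge> n" "c \<in> set (g m)" "m' \<ge> n" "d \<in> set (g m')"
    unfolding gap_set_def by auto
  have "set (gaps_between n (Suc (max m m' - n))) = {c, d}"
  proof
    show "set (gaps_between n (Suc (max m m' - n))) \<subseteq> {c, d}"
      using set_gaps_between_gap_set assms by metis
    show "{c, d} \<subseteq> set (gaps_between n (Suc (max m m' - n)))"
      unfolding set_gaps_between using m by auto
  qed
  then show ?thesis ..
qed

text \<open>A doubling gives the bound at once. A coarsening falls short by one block, so the
  argument is repeated with the merged block \<open>C\<close>; the gain of the first round then
  covers the deficit of the second.\<close>

lemma binary_gaps:
  assumes gap_set: "\<And>n. n \<ge> n0 \<Longrightarrow> gap_set n = {c, d}" and cd: "c < d" and n: "n \<ge> n0"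
  shows "\<exists>q\<ge>length (b n). 2 * excess q \<ge> int q + 2 * excess (length (b n)) - int (2 * c + 1)"
proof -
  obtain k where k: "set (gaps_between n k) = {c, d}" using gaps_between_full[OF gap_set n] by blast
  define V where "V = gaps_between n k"
  let ?h = "length (b n)"
  interpret B1: binary_coding L "b n" "\<Gamma>\<^sub>V V (n + k)" c d V
    by (rule binary_step[OF gap_set cd]) (use k n b_add b_first b_last V_def in auto)
  have finish: ?thesis if dbl: "B1.doubling"
  proof -
    obtain j z where "excess (Suc (2 * c + 2 * ?h + 2 * (j * (?h + z))))
     \<ge> excess (Suc (2 * c + ?h + j * (?h + z))) + int (j * (?h + z) + ?h)"
      using dbl unfolding B1.doubling_def by blast
    moreover have "excess (Suc (2 * c + ?h + j * (?h + z))) \<ge> excess ?h" by (rule excess_mono) simp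
    ultimately show ?thesis
      by (intro exI[of _ "Suc (2 * c + 2 * ?h + 2 * (j * (?h + z)))"]) auto
  qed
  show ?thesis
  proof (cases B1.doubling)
    case False
    then have B1.coarsening using B1.doubling_or_coarsening by blast
    then obtain m z vs where m: "z \<in> {c, d}" "m \<ge> 1" "set vs \<subseteq> {c, d}"
      "V = join_word (replicate m z) vs"
      "excess (Suc (2 * c + ?h + 2 * (m * (?h + z))))
        \<ge> excess (Suc (2 * c + ?h + m * (?h + z))) + int (m * (?h + z))"
      unfolding B1.coarsening_def by blast
    \<comment> \<open>The merged block consists of \<open>m + 1\<close> copies of
      \<open>b n\<close>, and \<open>b (n + k)\<close> has gap sequence \<open>vs\<close> over it.
      As \<open>vs\<close> may miss one of the gaps, a further stretch of \<open>k'\<close> stages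
      is joined on to obtain \<open>V'\<close> with both.\<close>
    define C where "C = block_word (b n) (replicate m z)"
    obtain k' where k': "set (gaps_between (n + k) k') = {c, d}"
      using gaps_between_full[OF gap_set, of "n + k"] n by auto
    define V' where "V' = join_word vs (gaps_between (n + k) k')"
    have bV: "b (n + k + k') = block_word C V'"
      unfolding C_def V'_def
      by (simp add: b_add[of "n + k" k'] b_add[of n k] m(4)[unfolded V_def] block_word_join_word)
    interpret B2: binary_coding L C "\<Gamma>\<^sub>V V' (n + k + k')" c d V'
    proof (rule binary_step[OF gap_set cd])
      show "set V' = {c, d}" using k' m(3) by (auto simp: V'_def set_join_word)
      show "\<exists>T. C = 0 # T" "\<exists>T. C = T @ [0]"
        unfolding C_def using b_first[of n] b_last[of n] block_word_first block_word_last by metis+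
    qed (use n bV in auto)
    have lC: "length C = m * (?h + z) + ?h"
      by (simp add: C_def length_block_word sum_list_replicate map_replicate)
    have "m * (?h + z) \<ge> 1 * ?h" using m(2) by (intro mult_mono) auto
    \<comment> \<open>The first gain is at least the block length, because \<open>m\<close> is at
      least 1.\<close>
    then have mh: "m * (?h + z) \<ge> ?h" by simp
    have base: "excess (Suc (2 * c + ?h + m * (?h + z))) \<ge> excess ?h" by (rule excess_mono) simp
    consider B2.doubling | B2.coarsening using B2.doubling_or_coarsening by blast
    then show ?thesis
    proof cases
      case 1
      then obtain j x where "excess (Suc (2 * c + 2 * length C + 2 * (j * (length C + x))))
         \<ge> excess (Suc (2 * c + length C + j * (length C + x))) + int (j * (length C + x) + length C)"
        unfolding B2.doubling_def by blast
      moreover have "excess (Suc (2 * c + length C + j * (length C + x))) \<ge> excess ?h"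
        by (rule excess_mono) (simp add: lC)
      ultimately show ?thesis
        by (intro exI[of _ "Suc (2 * c + 2 * length C + 2 * (j * (length C + x)))"]) (auto simp: lC)
    next
      case 2
      then obtain j x where j: "j \<ge> 1" "excess (Suc (2 * c + length C + 2 * (j * (length C + x))))
         \<ge> excess (Suc (2 * c + length C + j * (length C + x))) + int (j * (length C + x))"
        unfolding B2.coarsening_def by blast
      have "j * (length C + x) \<ge> 1 * length C" using j(1) by (intro mult_mono) auto
      \<comment> \<open>The second interval of growth starts beyond the end of the first, so the two
        gains add up.\<close>
      then have "excess (Suc (2 * c + length C + j * (length C + x)))
          \<ge> excess (Suc (2 * c + ?h + 2 * (m * (?h + z))))"
        using lC by (intro excess_mono) linarith
      then show ?thesis
        using j(2) m(5) base mh lC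
        by (intro exI[of _ "Suc (2 * c + length C + 2 * (j * (length C + x)))"] conjI) linarith+
    qed
  qed (use finish in blast)
qed

text \<open>The gap sets decrease and always have at least two elements; once there are no longer
  three, the set stays constant.\<close>

lemma gap_set_dichotomy:
  obtains (many) "\<And>n. \<exists>x\<in>gap_set n. \<exists>y\<in>gap_set n. \<exists>z\<in>gap_set n. x < y \<and> y < z"
  | (binary) n0 c d where "\<And>n. n \<ge> n0 \<Longrightarrow> gap_set n = {c, d}" "c < d"
proof (cases "\<forall>n. \<exists>x\<in>gap_set n. \<exists>y\<in>gap_set n. \<exists>z\<in>gap_set n. x < y \<and> y < z")
  case False
  then obtain n0 where n0: "\<not> (\<exists>x\<in>gap_set n0. \<exists>y\<in>gap_set n0. \<exists>z\<in>gap_set n0. x < y \<and> y < z)" by blast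
  obtain c d where cd: "c \<in> gap_set n0" "d \<in> gap_set n0" "c < d" "\<And>x. x \<in> gap_set n0 \<Longrightarrow> c \<le> x"
    using min_gap[of n0] by metis
  have "gap_set n0 \<subseteq> {c, d}"
  proof
    fix x assume x: "x \<in> gap_set n0"
    show "x \<in> {c, d}"
      using n0 cd x cd(4)[OF x] by (metis insertI1 insertI2 le_neq_implies_less linorder_neqE_nat)
  qed
  moreover have "{c, d} \<subseteq> gap_set n" if n: "n \<ge> n0" for n
  proof -
    obtain c' y where "c' \<in> gap_set n" "y \<in> gap_set n" "c' < y" by (rule min_gap[of n])
    then show ?thesis using gap_set_mono[OF n] \<open>gap_set n0 \<subseteq> {c, d}\<close> by auto
  qed
  ultimately have "gap_set n = {c, d}" if "n \<ge> n0" for n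
    using gap_set_mono[OF that] that by blast
  then show ?thesis using binary cd by blast
qed (use many in blast)

lemma excess_unbounded: "\<exists>q. excess q \<ge> M"
proof (cases rule: gap_set_dichotomy)
  case many
  obtain x y z where "x \<in> gap_set (nat M)" "y \<in> gap_set (nat M)" "z \<in> gap_set (nat M)" "x < y" "y < z"
    using many by blast
  then obtain c where "excess (Suc (2 * c + length (b (nat M)))) \<ge> int (c + length (b (nat M)))"
    using three_gaps by blast
  then show ?thesis using length_b[of "nat M"]
    by (intro exI[of _ "Suc (2 * c + length (b (nat M)))"]) linarith
next
  case (binary n0 c d)
  obtain n where n: "n = n0 + nat (2 * M) + 2 * c + 1" by blast
  have "n0 \<le> n" using n by simp
  then obtain q where q: "q \<ge> length (b n)" "2 * excess q \<ge> int q + 2 * excess (length (b n)) - int (2 * c + 1)"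
    using binary_gaps[OF binary] by blast
  have "excess (length (b n)) \<ge> 0" "length (b n) > n" using excess_nonneg length_b by auto
  then show ?thesis using q n by (intro exI[of _ q]) linarith
qed

lemma excess_tendsto: "\<exists>q0. \<forall>q\<ge>q0. excess q \<ge> M"
  using excess_unbounded[of M] excess_mono by (meson order.trans)

text \<open>Bootstrapping in the binary case: the constant \<open>2 * c + 1\<close> lost in
  \<open>binary_gaps\<close> is outweighed by the excess at \<open>length (b n)\<close>, which is
  already known to tend to infinity.\<close>

lemma excess_half_unbounded: "\<exists>q. 2 * excess q \<ge> int q + M"
proof (cases rule: gap_set_dichotomy)
  case many
  let ?n = "nat M + 1"
  obtain x y z where "x \<in> gap_set ?n" "y \<in> gap_set ?n" "z \<in> gap_set ?n" "x < y" "y < z"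
    using many by blast
  then obtain c where "excess (Suc (2 * c + length (b ?n))) \<ge> int (c + length (b ?n))"
    using three_gaps by blast
  then show ?thesis using length_b[of ?n]
    by (intro exI[of _ "Suc (2 * c + length (b ?n))"]) linarith
next
  case (binary n0 c d)
  obtain q0 where q0: "\<And>q. q \<ge> q0 \<Longrightarrow> excess q \<ge> M + int (2 * c + 1)"
    using excess_tendsto[of "M + int (2 * c + 1)"] by blast
  let ?n = "n0 + q0"
  obtain q where q: "2 * excess q \<ge> int q + 2 * excess (length (b ?n)) - int (2 * c + 1)"
    using binary_gaps[OF binary, of ?n] by auto
  have "excess (length (b ?n)) \<ge> M + int (2 * c + 1)" "excess (length (b ?n)) \<ge> 0"
    using q0[of "length (b ?n)"] length_b[of ?n] excess_nonneg by auto
  then show ?thesis using q by (intro exI[of _ q]) linarith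
qed

end

section \<open>From finite words to the subshift and its complexity\<close>

lemma bi_infinite_extension:
  fixes L :: "'a list set"
  assumes fact: "\<And>w u. w \<in> L \<Longrightarrow> sublist u w \<Longrightarrow> u \<in> L"
    and left: "\<And>w. w \<in> L \<Longrightarrow> \<exists>a. a # w \<in> L"
    and right: "\<And>w. w \<in> L \<Longrightarrow> \<exists>a. w @ [a] \<in> L"
    and w: "w \<in> L"
  shows "\<exists>x :: int \<Rightarrow> 'a. (\<forall>k q. map (\<lambda>i. x (k + int i)) [0..<q] \<in> L) \<and>
    map (\<lambda>i. x (int i)) [0..<length w] = w"
proof -
  have "\<exists>v\<in>L. \<exists>a c. v = a # u @ [c]" if u: "u \<in> L" for u
  proof -
    obtain a where "a # u \<in> L" using left[OF u] by blast
    then obtain c where "(a # u) @ [c] \<in> L" using right by blast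
    then show ?thesis by (intro bexI[of _ "(a # u) @ [c]"]) auto
  qed
  then have "\<forall>u. \<exists>v. u \<in> L \<longrightarrow> v \<in> L \<and> (\<exists>a c. v = a # u @ [c])" by blast
  then obtain f where f: "\<And>u. u \<in> L \<Longrightarrow> f u \<in> L \<and> (\<exists>a c. f u = a # u @ [c])" by metis
  define W where "W n = (f ^^ n) w" for n
  have W_L: "W n \<in> L" for n by (induction n) (auto simp: W_def w f)
  have W_Suc: "\<exists>a c. W (Suc n) = a # W n @ [c]" for n
    using f[OF W_L[of n]] by (simp add: W_def)
  have len: "length (W n) = length w + 2 * n" for n
  proof (induction n)
    case (Suc n) then show ?case using W_Suc[of n] by auto
  qed (simp add: W_def)
  have nth_Suc: "W (Suc n) ! Suc i = W n ! i" if "i < length (W n)" for n i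
    using W_Suc[of n] that by (auto simp: nth_append)
  have nth_add: "W (n + m) ! (i + m) = W n ! i" if "i < length (W n)" for n m i
  proof (induction m)
    case (Suc m)
    then show ?case using nth_Suc[of "i + m" "n + m"] that by (simp add: len)
  qed simp
  \<comment> \<open>Each step adds one letter on either side, so coordinate \<open>i\<close> sits at
    index \<open>i + n\<close> of \<open>W n\<close>. The choice of \<open>n\<close> as the absolute
    value of \<open>i\<close> plus 1 makes this index valid even for empty \<open>w\<close>.\<close>
  define x where "x i = W (nat \<bar>i\<bar> + 1) ! nat (i + int (nat \<bar>i\<bar> + 1))" for i
  have x: "x i = W n ! nat (i + int n)" if "0 \<le> i + int n" "i + int n < length (W n)" for i n
  proof (cases "n \<le> nat \<bar>i\<bar> + 1")
    case True
    define m where "m = nat \<bar>i\<bar> + 1 - n"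
    have "nat \<bar>i\<bar> + 1 = n + m" using True by (simp add: m_def)
    moreover have "nat (i + int (n + m)) = nat (i + int n) + m" using that by simp
    ultimately show ?thesis unfolding x_def
      using nth_add[of "nat (i + int n)" n m] that by simp
  next
    case False
    define k where "k = nat \<bar>i\<bar> + 1"
    define m where "m = n - k"
    have n: "n = k + m" using False by (simp add: m_def k_def)
    have "nat (i + int n) = nat (i + int k) + m" using n by (simp add: k_def)
    moreover have "nat (i + int k) < length (W k)" using len[of k] by (simp add: k_def)
    ultimately show ?thesis unfolding x_def k_def[symmetric]
      using nth_add[of "nat (i + int k)" k m] n by simp
  qed
  have "map (\<lambda>i. x (k + int i)) [0..<q] \<in> L" for k q
  proof -
    define n where "n = nat \<bar>k\<bar> + q"
    have b: "0 \<le> k + int n" "k + int n + int q \<le> length (W n)"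
      by (simp_all add: n_def len) 
    have "map (\<lambda>i. x (k + int i)) [0..<q] = take q (drop (nat (k + int n)) (W n))"
    proof (rule nth_equalityI)
      fix i assume "i < length (map (\<lambda>i. x (k + int i)) [0..<q])"
      then have i: "i < q" by simp
      have "x (k + int i) = W n ! nat (k + int i + int n)"
        by (rule x) (use b i in auto)
      also have "nat (k + int i + int n) = nat (k + int n) + i" using b by simp
      finally show "map (\<lambda>i. x (k + int i)) [0..<q] ! i = take q (drop (nat (k + int n)) (W n)) ! i"
        using i b by simp
    qed (use b in auto)
    then show ?thesis
      using fact[OF W_L] by (metis sublist_take sublist_drop sublist_order.order.trans)
  qed
  moreover have "map (\<lambda>i. x (int i)) [0..<length w] = w"
  proof (rule nth_equalityI)
    fix i assume "i < length (map (\<lambda>i. x (int i)) [0..<length w])"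
    then show "map (\<lambda>i. x (int i)) [0..<length w] ! i = w ! i"
      using x[of "int i" 0] by (simp add: W_def)
  qed simp
  ultimately show ?thesis by blast
qed

text \<open>The spacers on the last subcolumn of each stage remain at the end of all later words, so
  these are the final spacers that are stripped to obtain \<open>b n\<close>.\<close>

definition trailing :: "(nat \<Rightarrow> nat) \<Rightarrow> (nat \<Rightarrow> nat \<Rightarrow> nat) \<Rightarrow> nat \<Rightarrow> nat" where
  "trailing r s n = (\<Sum>k<n. s k (r k))"

text \<open>A gap consists of the trailing spacers of the preceding copy and the newly inserted
  ones. The index \<open>r n\<close> is left out: its spacers are passed on to
  \<open>trailing\<close> of the next stage.\<close>

definition gap_list :: "(nat \<Rightarrow> nat) \<Rightarrow> (nat \<Rightarrow> nat \<Rightarrow> nat) \<Rightarrow> nat \<Rightarrow> nat list" where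
  "gap_list r s n = map (\<lambda>i. trailing r s n + s n i) [0..<r n]"

locale rank_one =
  fixes r :: "nat \<Rightarrow> nat" and s :: "nat \<Rightarrow> nat \<Rightarrow> nat"
  assumes r_pos: "1 \<le> r n"
begin

sublocale gap_sequence "gap_list r s"
proof
  fix n show "gap_list r s n \<noteq> []" using r_pos[of n] by (simp add: gap_list_def)
qed

lemma concat_blocks:
  "concat (map (\<lambda>i. (B @ replicate t 1) @ replicate (f i) 1) [0..<Suc m])
   = block_word B (map (\<lambda>i. t + f i) [0..<m]) @ replicate (t + f m) 1"
proof (induction m)
  case (Suc m)
  have "concat (map (\<lambda>i. (B @ replicate t 1) @ replicate (f i) 1) [0..<Suc (Suc m)])
    = (block_word B (map (\<lambda>i. t + f i) [0..<m]) @ replicate (t + f m) 1)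
      @ (B @ replicate t 1) @ replicate (f (Suc m)) 1"
    using Suc.IH by simp
  then show ?case by (simp add: block_word_append replicate_add)
qed (simp add: replicate_add)

lemma ro_word_b: "ro_word r s n = b n @ replicate (trailing r s n) 1"
proof (induction n)
  case (Suc n)
  have "b (Suc n) = block_word (b n) (map (\<lambda>i. trailing r s n + s n i) [0..<r n])"
    unfolding b.simps gap_list_def ..
  then show ?case unfolding ro_word.simps Suc.IH concat_blocks by (simp add: trailing_def)
qed (simp add: trailing_def)

text \<open>Stripping does not change the language: \<open>b n\<close> is a prefix of the full word,
  and the full word is a prefix of \<open>b (Suc n)\<close>, whose first gap contains the trailing
  spacers.\<close>

lemma sublist_ro_word: "(\<exists>n. sublist w (ro_word r s n)) \<longleftrightarrow> w \<in> L"
proof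
  assume "\<exists>n. sublist w (ro_word r s n)"
  then obtain n where n: "sublist w (ro_word r s n)" ..
  obtain hs where g: "gap_list r s n = (trailing r s n + s n 0) # hs"
    using r_pos[of n] by (auto simp: gap_list_def upt_conv_Cons)
  have "b (Suc n) = ro_word r s n @ replicate (s n 0) 1 @ block_word (b n) hs"
    by (simp add: g ro_word_b replicate_add)
  then have "sublist (ro_word r s n) (b (Suc n))" by simp
  then show "w \<in> L" unfolding L_def using n sublist_order.order.trans by blast
next
  assume "w \<in> L"
  then show "\<exists>n. sublist w (ro_word r s n)"
    unfolding L_def ro_word_b using sublist_append_rightI sublist_order.order.trans by blast
qed

lemma ro_complexity_L: "ro_complexity r s q = card {w \<in> L. length w = q}"
proof -
  have X: "x \<in> ro_subshift r s \<longleftrightarrow> (\<forall>k q. map (\<lambda>i. x (k + int i)) [0..<q] \<in> L)" for x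
    unfolding ro_subshift_def sublist_ro_word[symmetric] sublist_def by simp
  have "{w. \<exists>x\<in>ro_subshift r s. \<exists>k::int. w = map (\<lambda>i. x (k + int i)) [0..<q]}
      = {w \<in> L. length w = q}"
  proof (intro equalityI subsetI)
    fix w assume "w \<in> {w \<in> L. length w = q}"
    then have w: "w \<in> L" "length w = q" by auto
    have "\<exists>x :: int \<Rightarrow> nat. (\<forall>k q. map (\<lambda>i. x (k + int i)) [0..<q] \<in> L) \<and>
        map (\<lambda>i. x (int i)) [0..<length w] = w"
      by (rule bi_infinite_extension) (fact L_factorial L_left_ext L_right_ext w)+
    then obtain x where x: "\<forall>k q. map (\<lambda>i. x (k + int i)) [0..<q] \<in> L"
      "map (\<lambda>i. x (int i)) [0..<q] = w"
      using w(2) by blast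
    then show "w \<in> {w. \<exists>x\<in>ro_subshift r s. \<exists>k::int. w = map (\<lambda>i. x (k + int i)) [0..<q]}"
      unfolding mem_Collect_eq by (intro bexI[of _ x] exI[of _ 0]) (simp_all add: X)
  qed (auto simp: X)
  then show ?thesis by (simp add: ro_complexity_def)
qed

lemma complexity_limits:
  assumes "\<And>n x. gap_set n \<noteq> {x}"
  shows "limsup (\<lambda>q. ereal (real (ro_complexity r s q) - 3/2 * real q)) = \<infinity>"
    and "liminf (\<lambda>q. ereal (real (ro_complexity r s q) - real q)) = \<infinity>"
proof -
  interpret aperiodic_gaps "gap_list r s" by unfold_locales (fact assms)
  have excess: "real_of_int (excess q) = real (ro_complexity r s q) - real q" for q
    by (simp add: excess_def ro_complexity_L)
  have "((\<lambda>q. ereal (real (ro_complexity r s q) - real q)) \<longlongrightarrow> \<infinity>) sequentially"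
    unfolding tendsto_PInfty eventually_sequentially
  proof
    fix M :: real
    obtain q0 where q0: "\<And>q. q \<ge> q0 \<Longrightarrow> excess q \<ge> \<lfloor>M\<rfloor> + 1" using excess_tendsto by blast
    have "ereal M < ereal (real (ro_complexity r s q) - real q)" if "q \<ge> q0" for q
    proof -
      have "real_of_int (excess q) \<ge> real_of_int (\<lfloor>M\<rfloor> + 1)"
        using q0[OF that] of_int_le_iff by blast
      then have "M < real_of_int (excess q)" by linarith
      then show ?thesis unfolding excess by simp
    qed
    then show "\<exists>N. \<forall>n\<ge>N. ereal M < ereal (real (ro_complexity r s n) - real n)" by blast
  qed
  then show "liminf (\<lambda>q. ereal (real (ro_complexity r s q) - real q)) = \<infinity>"
    by (intro lim_imp_Liminf) auto
  let ?f = "\<lambda>q. real (ro_complexity r s q) - 3/2 * real q"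
  have f: "?f q = (2 * real_of_int (excess q) - real q) / 2" for q
    unfolding excess by simp
  have big: "\<exists>q\<ge>n. ?f q > M" for M n
  proof -
    \<comment> \<open>The sum bounds every \<open>2 * excess q\<close> with
      \<open>q \<le> n\<close>; this forces the \<open>q\<close> obtained below to exceed
      \<open>n\<close>, as the limsup requires.\<close>
    define K where "K = \<lceil>2 * \<bar>M\<bar>\<rceil> + 1 + (\<Sum>q\<le>n. \<bar>2 * excess q\<bar>)"
    obtain q where q: "2 * excess q \<ge> int q + K" using excess_half_unbounded by blast
    have K: "real_of_int K > 2 * M"
    proof -
      have "(\<Sum>q\<le>n. \<bar>2 * excess q\<bar>) \<ge> 0" by (intro sum_nonneg) auto
      then have "K \<ge> \<lceil>2 * \<bar>M\<bar>\<rceil> + 1" by (simp add: K_def)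
      then show ?thesis by linarith
    qed
    have "\<not> q \<le> n"
    proof
      assume "q \<le> n"
      then have "\<bar>2 * excess q\<bar> \<le> (\<Sum>q\<le>n. \<bar>2 * excess q\<bar>)"
        by (intro member_le_sum) auto
      moreover have "\<lceil>2 * \<bar>M\<bar>\<rceil> \<ge> 0" by simp
      ultimately show False using q unfolding K_def by linarith
    qed
    moreover have "real_of_int (2 * excess q) \<ge> real_of_int (int q + K)"
      using q of_int_le_iff by blast
    ultimately show ?thesis using K unfolding f by (intro exI[of _ q]) auto
  qed
  have "limsup (\<lambda>q. ereal (?f q)) \<ge> ereal M" for M
  proof -
    have "ereal M \<le> (SUP q\<in>{n..}. ereal (?f q))" for n
    proof -
      obtain q where q: "q \<ge> n" "?f q > M" using big by blast
      have "ereal M \<le> ereal (?f q)" using q by simp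
      also have "\<dots> \<le> (SUP q\<in>{n..}. ereal (?f q))" using q by (intro SUP_upper) auto
      finally show ?thesis .
    qed
    then show ?thesis unfolding limsup_INF_SUP by (intro INF_greatest)
  qed
  then show "limsup (\<lambda>q. ereal (?f q)) = \<infinity>"
    by (intro ereal_top)
qed

end

section \<open>Levels of the columns\<close>

lemma partial_sum_unique:
  fixes a :: "nat \<Rightarrow> nat"
  assumes "(\<Sum>k<i. a k) + e = (\<Sum>k<i'. a k) + e'" "e < a i" "e' < a i'"
  shows "i = i' \<and> e = e'"
proof -
  have aux: "(\<Sum>k<p. a k) + u < (\<Sum>k<q. a k) + v" if "p < q" "u < a p" for p q u v
  proof -
    have "(\<Sum>k<p. a k) + u < (\<Sum>k<Suc p. a k)" using that by simp
    also have "\<dots> \<le> (\<Sum>k<q. a k)" using that by (intro sum_mono2) auto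
    finally show ?thesis by simp
  qed
  have "i = i'"
    using aux[of i i' e e'] aux[of i' i e' e] assms by (metis linorder_neqE_nat less_irrefl)
  then show ?thesis using assms by simp
qed

lemma partial_sum_decomp:
  fixes a :: "nat \<Rightarrow> nat"
  assumes "k < (\<Sum>j<n. a j)"
  obtains i d where "i < n" "d < a i" "k = (\<Sum>j<i. a j) + d"
  using assms
proof (induction n arbitrary: thesis)
  case (Suc n)
  show ?case
  proof (cases "k < (\<Sum>j<n. a j)")
    case True
    then show ?thesis using Suc.IH Suc.prems(1) less_Suc_eq by metis
  next
    case False
    then show ?thesis using Suc.prems by (intro Suc.prems(1)[of n "k - (\<Sum>j<n. a j)"]) auto
  qed
qed simp

context
  fixes r :: "nat \<Rightarrow> nat" and s :: "nat \<Rightarrow> nat \<Rightarrow> nat"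
begin

lemma ro_hgt_pos: "0 < ro_hgt r s n"
  by (induction n) auto

lemma ro_wid_pos: "0 < ro_wid r n"
  by (induction n) auto

lemma ro_wid_Suc: "ro_wid r n = real (r n + 1) * ro_wid r (Suc n)"
  by simp

lemma ro_hgt_blockstart: "ro_hgt r s (Suc n) = ro_blockstart r s n (Suc (r n))"
  by (simp add: ro_blockstart_def sum.distrib lessThan_Suc_atMost)

lemma blockstart_decomp:
  assumes "k < ro_hgt r s (Suc n)"
  obtains i d where "i \<le> r n" "d < ro_hgt r s n + s n i" "k = ro_blockstart r s n i + d"
proof -
  have "k < (\<Sum>i<Suc (r n). ro_hgt r s n + s n i)"
    using assms unfolding ro_hgt_blockstart ro_blockstart_def .
  then obtain i d where i: "i < Suc (r n)" "d < ro_hgt r s n + s n i"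
    "k = (\<Sum>j<i. ro_hgt r s n + s n j) + d"
    by (rule partial_sum_decomp)
  show ?thesis by (rule that[of i d]) (use i in \<open>auto simp: ro_blockstart_def\<close>)
qed

lemma blockstart_less:
  assumes "i \<le> r n" "d < ro_hgt r s n + s n i"
  shows "ro_blockstart r s n i + d < ro_hgt r s (Suc n)"
proof -
  have "ro_blockstart r s n i + d < (\<Sum>k<Suc i. ro_hgt r s n + s n k)"
    using assms by (simp add: ro_blockstart_def)
  also have "\<dots> \<le> (\<Sum>k<Suc (r n). ro_hgt r s n + s n k)"
    using assms by (intro sum_mono2) auto
  finally show ?thesis by (simp only: ro_hgt_blockstart ro_blockstart_def)
qed

lemma blockstart_LEAST:
  assumes "d < ro_hgt r s n + s n i"
  shows "(LEAST i'. ro_blockstart r s n i + d < ro_blockstart r s n (Suc i')) = i"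
proof (rule Least_equality)
  show "ro_blockstart r s n i + d < ro_blockstart r s n (Suc i)"
    using assms by (simp add: ro_blockstart_def)
  fix j assume j: "ro_blockstart r s n i + d < ro_blockstart r s n (Suc j)"
  show "i \<le> j"
  proof (rule ccontr)
    assume "\<not> i \<le> j"
    then have "ro_blockstart r s n (Suc j) \<le> ro_blockstart r s n i"
      unfolding ro_blockstart_def by (intro sum_mono2) auto
    then show False using j by simp
  qed
qed

lemma ro_lev_block:
  assumes "d < ro_hgt r s n"
  shows "ro_lev r s (Suc n) (ro_blockstart r s n i + d) = ro_lev r s n d + real i * ro_wid r (Suc n)"
  using assms blockstart_LEAST[of d n i] by (simp add: Let_def)

lemma ro_lev_spacer:
  assumes "e < s n i"
  shows "ro_lev r s (Suc n) (ro_blockstart r s n i + (ro_hgt r s n + e))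
    = real (ro_hgt r s n) * ro_wid r n + real ((\<Sum>k<i. s n k) + e) * ro_wid r (Suc n)"
  using assms blockstart_LEAST[of "ro_hgt r s n + e" n i] by (simp add: Let_def)

lemma mult_add_unique:
  fixes c :: nat
  assumes "a * c + i = a' * c + i'" "i < c" "i' < c"
  shows "a = a' \<and> i = i'"
proof -
  have "(a * c + i) div c = a" "(a' * c + i') div c = a'" using assms(2,3) by simp_all
  then have "a = a'" unfolding assms(1) by simp
  with assms(1) show ?thesis by simp
qed

lemma mult_add_less:
  fixes c :: nat
  assumes "a < h" "i < c"
  shows "a * c + i < c * h"
proof -
  have "a * c + i < (a + 1) * c" using assms(2) by simp
  also have "\<dots> \<le> h * c" using assms(1) by (intro mult_le_mono1) simp
  finally show ?thesis by (simp only: mult.commute)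
qed

text \<open>The map \<open>p\<close> gives the place of each level on the line, counted in widths.
  Disjointness of levels and their inclusion in one interval follow from it.\<close>

lemma ro_lev_position:
  "\<exists>p. inj_on p {..<ro_hgt r s n} \<and> p ` {..<ro_hgt r s n} \<subseteq> {..<ro_hgt r s n}
    \<and> (\<forall>k<ro_hgt r s n. ro_lev r s n k = real (p k) * ro_wid r n)"
proof (induction n)
  case 0
  show ?case by (rule exI[of _ id]) simp
next
  case (Suc n)
  let ?h = "ro_hgt r s n" and ?h' = "ro_hgt r s (Suc n)" and ?w' = "ro_wid r (Suc n)"
  obtain p where p: "inj_on p {..<?h}" "\<And>k. k < ?h \<Longrightarrow> p k < ?h"
    "\<And>k. k < ?h \<Longrightarrow> ro_lev r s n k = real (p k) * ro_wid r n"
    using Suc unfolding image_subset_iff lessThan_iff Ball_def by blast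
  \<comment> \<open>\<open>P k q\<close> says that level \<open>k\<close> of the new column has
    position \<open>q\<close>. An old position splits into \<open>r n + 1\<close> consecutive ones,
    one per subcolumn; the spacers come after all of these.\<close>
  define P where "P k q \<longleftrightarrow> (\<exists>i\<le>r n. (\<exists>d<?h. k = ro_blockstart r s n i + d \<and> q = p d * (r n + 1) + i) \<or>
     (\<exists>e<s n i. k = ro_blockstart r s n i + (?h + e) \<and> q = (r n + 1) * ?h + ((\<Sum>j<i. s n j) + e)))"
    for k q
  have ex: "\<exists>q. P k q" if k: "k < ?h'" for k
  proof -
    obtain i d where i: "i \<le> r n" "d < ?h + s n i" "k = ro_blockstart r s n i + d"
      by (rule blockstart_decomp[OF k])
    show ?thesis
    proof (cases "d < ?h")
      case False
      then have "d = ?h + (d - ?h)" "d - ?h < s n i" using i(2) by linarith+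
      then have "P k ((r n + 1) * ?h + ((\<Sum>j<i. s n j) + (d - ?h)))"
        using i(1,3) unfolding P_def by metis
      then show ?thesis ..
    next
      case True
      then have "P k (p d * (r n + 1) + i)" using i(1,3) unfolding P_def by blast
      then show ?thesis ..
    qed
  qed
  have hgt: "?h' = (r n + 1) * ?h + (\<Sum>j\<le>r n. s n j)" by simp
  have less: "q < ?h'" if Pkq: "P k q" for k q
  proof -
    obtain i where i: "i \<le> r n" and or: "(\<exists>d<?h. k = ro_blockstart r s n i + d \<and> q = p d * (r n + 1) + i) \<or>
     (\<exists>e<s n i. k = ro_blockstart r s n i + (?h + e) \<and> q = (r n + 1) * ?h + ((\<Sum>j<i. s n j) + e))"
      using Pkq unfolding P_def by (elim exE conjE)
    from or show ?thesis
    proof (elim disjE exE conjE)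
      fix d assume d: "d < ?h" "q = p d * (r n + 1) + i" and "k = ro_blockstart r s n i + d"
      have "q < (r n + 1) * ?h"
        unfolding d(2) by (rule mult_add_less[OF p(2)[OF d(1)]]) (use i in simp)
      then show ?thesis unfolding hgt by linarith
    next
      fix e assume e: "e < s n i" "q = (r n + 1) * ?h + ((\<Sum>j<i. s n j) + e)"
        and "k = ro_blockstart r s n i + (?h + e)"
      have "(\<Sum>j<i. s n j) + e < (\<Sum>j<Suc i. s n j)" using e(1) by simp
      also have "\<dots> \<le> (\<Sum>j\<le>r n. s n j)" using i by (intro sum_mono2) auto
      finally show ?thesis unfolding hgt e(2) by linarith
    qed
  qed
  have lev: "ro_lev r s (Suc n) k = real q * ?w'" if Pkq: "P k q" for k q
  proof -
    obtain i where i: "i \<le> r n" and or: "(\<exists>d<?h. k = ro_blockstart r s n i + d \<and> q = p d * (r n + 1) + i) \<or>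
     (\<exists>e<s n i. k = ro_blockstart r s n i + (?h + e) \<and> q = (r n + 1) * ?h + ((\<Sum>j<i. s n j) + e))"
      using Pkq unfolding P_def by (elim exE conjE)
    from or show ?thesis
    proof (elim disjE exE conjE)
      fix d assume d: "d < ?h" "k = ro_blockstart r s n i + d" "q = p d * (r n + 1) + i"
      show ?thesis unfolding d(2) ro_lev_block[OF d(1)] p(3)[OF d(1)] d(3) ro_wid_Suc[of n]
        by (simp only: of_nat_add of_nat_mult distrib_right mult.assoc)
    next
      fix e assume e: "e < s n i" "k = ro_blockstart r s n i + (?h + e)"
        "q = (r n + 1) * ?h + ((\<Sum>j<i. s n j) + e)"
      show ?thesis unfolding e(2) ro_lev_spacer[OF e(1)] e(3) ro_wid_Suc[of n]
        by (simp add: algebra_simps del: ro_wid.simps)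
    qed
  qed
  have inj: "k = k'" if Pkq: "P k q" and Pkq': "P k' q" for k k' q
  proof -
    have div: "p d * (r n + 1) + i < (r n + 1) * ?h" if "i \<le> r n" "d < ?h" for i d
      by (rule mult_add_less[OF p(2)[OF that(2)]]) (use that in simp)
    obtain i where i: "i \<le> r n" and or: "(\<exists>d<?h. k = ro_blockstart r s n i + d \<and> q = p d * (r n + 1) + i) \<or>
     (\<exists>e<s n i. k = ro_blockstart r s n i + (?h + e) \<and> q = (r n + 1) * ?h + ((\<Sum>j<i. s n j) + e))"
      using Pkq unfolding P_def by (elim exE conjE)
    obtain i' where i': "i' \<le> r n" and or': "(\<exists>d<?h. k' = ro_blockstart r s n i' + d \<and> q = p d * (r n + 1) + i') \<or>
     (\<exists>e<s n i'. k' = ro_blockstart r s n i' + (?h + e) \<and> q = (r n + 1) * ?h + ((\<Sum>j<i'. s n j) + e))"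
      using Pkq' unfolding P_def by (elim exE conjE)
    from or show ?thesis
    proof (elim disjE exE conjE)
      fix d assume d: "d < ?h" "k = ro_blockstart r s n i + d" "q = p d * (r n + 1) + i"
      have "q < (r n + 1) * ?h" using div[OF i d(1)] d(3) by simp
      then have "\<not> (\<exists>e<s n i'. q = (r n + 1) * ?h + ((\<Sum>j<i'. s n j) + e))" by linarith
      then obtain d' where d': "d' < ?h" "k' = ro_blockstart r s n i' + d'" "q = p d' * (r n + 1) + i'"
        using or' by blast
      have "p d = p d' \<and> i = i'"
        by (rule mult_add_unique[of _ "r n + 1"]) (use d(3) d'(3) i i' in simp_all)
      then have "d = d'" "i = i'" using inj_onD[OF p(1), of d d'] d(1) d'(1) by simp_all
      then show ?thesis using d(2) d'(2) by simp
    next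
      fix e assume e: "e < s n i" "k = ro_blockstart r s n i + (?h + e)"
        "q = (r n + 1) * ?h + ((\<Sum>j<i. s n j) + e)"
      have "\<not> q < (r n + 1) * ?h" using e(3) by simp
      then obtain e' where e': "e' < s n i'" "k' = ro_blockstart r s n i' + (?h + e')"
        "q = (r n + 1) * ?h + ((\<Sum>j<i'. s n j) + e')"
        using or' div[OF i'] by blast
      have "(\<Sum>j<i. s n j) + e = (\<Sum>j<i'. s n j) + e'" using e(3) e'(3) by simp
      then have "i = i' \<and> e = e'" using e(1) e'(1) by (rule partial_sum_unique)
      then show ?thesis using e e' by simp
    qed
  qed
  define p' where "p' k = (SOME q. P k q)" for k
  have P: "P k (p' k)" if "k < ?h'" for k
    unfolding p'_def using ex[OF that] by (rule someI_ex)
  show ?case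
  proof (intro exI[of _ p'] conjI allI impI image_subsetI)
    show "inj_on p' {..<?h'}"
    proof (rule inj_onI)
      fix x y assume "x \<in> {..<?h'}" "y \<in> {..<?h'}" "p' x = p' y"
      then show "x = y" using P[of x] P[of y] inj by auto
    qed
  next
    fix k assume "k \<in> {..<?h'}"
    then show "p' k \<in> {..<?h'}" using less[OF P[of k]] by simp
  next
    fix k assume "k < ?h'"
    then show "ro_lev r s (Suc n) k = real (p' k) * ?w'" by (intro lev P)
  qed
qed

lemma level_disjoint:
  assumes "x \<in> ro_level r s n k" "x \<in> ro_level r s n k'" "k < ro_hgt r s n" "k' < ro_hgt r s n"
  shows "k = k'"
proof -
  obtain p where p: "inj_on p {..<ro_hgt r s n}"
    "\<And>k. k < ro_hgt r s n \<Longrightarrow> ro_lev r s n k = real (p k) * ro_wid r n"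
    using ro_lev_position by blast
  have aux: "p i \<le> p j" if "x \<in> ro_level r s n i" "x \<in> ro_level r s n j"
    "i < ro_hgt r s n" "j < ro_hgt r s n" for i j
  proof -
    have "real (p i) * ro_wid r n < real (p j + 1) * ro_wid r n"
      using that p(2) by (simp add: ro_level_def algebra_simps)
    then have "real (p i) < real (p j + 1)" by (simp only: mult_less_cancel_right_pos[OF ro_wid_pos])
    then show ?thesis by simp
  qed
  have "p k = p k'" using aux[OF assms] aux[OF assms(2,1,4,3)] by simp
  then show ?thesis using p(1) assms by (auto dest: inj_onD)
qed

lemma level_subset:
  assumes "k < ro_hgt r s n"
  shows "ro_level r s n k \<subseteq> {0..<real (ro_hgt r s n) * ro_wid r n}"
proof -
  obtain p where p: "p k < ro_hgt r s n" "ro_lev r s n k = real (p k) * ro_wid r n"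
    using ro_lev_position assms by (metis image_subset_iff lessThan_iff)
  have "real (p k + 1) * ro_wid r n \<le> real (ro_hgt r s n) * ro_wid r n"
    using p(1) ro_wid_pos[of n] by (intro mult_right_mono) auto
  moreover have "0 \<le> real (p k) * ro_wid r n" using ro_wid_pos[of n] by simp
  ultimately show ?thesis using p(2) by (auto simp: ro_level_def algebra_simps)
qed

lemma level_lift:
  assumes "x \<in> ro_level r s n k" "k < ro_hgt r s n"
  obtains i where "i \<le> r n" "x \<in> ro_level r s (Suc n) (ro_blockstart r s n i + k)"
proof -
  let ?w = "ro_wid r (Suc n)" and ?t = "x - ro_lev r s n k"
  have w: "?w > 0" by (rule ro_wid_pos)
  have t: "0 \<le> ?t" "?t < real (r n + 1) * ?w"
    using assms(1) unfolding ro_level_def ro_wid_Suc[of n] by auto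
  \<comment> \<open>The subcolumn that contains \<open>x\<close>, found by measuring its offset in
    the level in units of the new width.\<close>
  define i where "i = nat \<lfloor>?t / ?w\<rfloor>"
  have "0 \<le> ?t / ?w" using t(1) w by (intro divide_nonneg_pos)
  then have i: "real i \<le> ?t / ?w" "?t / ?w < real i + 1"
    unfolding i_def by linarith+
  have "real i * ?w \<le> ?t" using i(1) by (simp only: pos_le_divide_eq[OF w])
  moreover have "?t < (real i + 1) * ?w" using i(2) by (simp only: pos_divide_less_eq[OF w])
  then have "?t < real i * ?w + ?w" by (simp only: distrib_right mult_1)
  moreover have "?t / ?w < real (r n + 1)" using t(2) by (simp only: pos_divide_less_eq[OF w])
  then have "i \<le> r n" using i(1) by linarith
  ultimately show ?thesis
    using that[of i] unfolding ro_level_def ro_lev_block[OF assms(2), of i] atLeastLessThan_iff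
    by linarith
qed

text \<open>Two consecutive levels are cut alike, so their sublevels in one subcolumn are
  consecutive and differ by the same translation.\<close>

lemma level_lift_step:
  assumes "x \<in> ro_level r s n k" "Suc k < ro_hgt r s n" "n \<le> m"
  shows "\<exists>k'. x \<in> ro_level r s m k' \<and> Suc k' < ro_hgt r s m \<and>
    ro_lev r s m (Suc k') - ro_lev r s m k' = ro_lev r s n (Suc k) - ro_lev r s n k"
  using assms(3)
proof (induction m rule: dec_induct)
  case base
  then show ?case using assms by auto
next
  case (step m)
  then obtain k' where k': "x \<in> ro_level r s m k'" "Suc k' < ro_hgt r s m"
    "ro_lev r s m (Suc k') - ro_lev r s m k' = ro_lev r s n (Suc k) - ro_lev r s n k" by blast
  obtain i where i: "i \<le> r m" "x \<in> ro_level r s (Suc m) (ro_blockstart r s m i + k')"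
    using level_lift[OF k'(1)] k'(2) by auto
  have "Suc (ro_blockstart r s m i + k') < ro_hgt r s (Suc m)"
    using blockstart_less[OF i(1), of "Suc k'"] k'(2) by simp
  moreover have "ro_lev r s (Suc m) (Suc (ro_blockstart r s m i + k'))
      - ro_lev r s (Suc m) (ro_blockstart r s m i + k') = ro_lev r s n (Suc k) - ro_lev r s n k"
    using ro_lev_block[of "Suc k'" m i] ro_lev_block[of k' m i] k'(2,3)
    by (simp del: ro_lev.simps)
  ultimately show ?case using i(2) by blast
qed

lemma level_lift_any:
  assumes "x \<in> ro_level r s n k" "k < ro_hgt r s n" "n \<le> m"
  shows "\<exists>k'<ro_hgt r s m. x \<in> ro_level r s m k'"
  using assms(3)
proof (induction m rule: dec_induct)
  case (step m)
  then obtain k' where k': "x \<in> ro_level r s m k'" "k' < ro_hgt r s m" by blast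
  obtain i where i: "i \<le> r m" "x \<in> ro_level r s (Suc m) (ro_blockstart r s m i + k')"
    by (rule level_lift[OF k'])
  then show ?case using blockstart_less[OF i(1), of k'] k'(2) by auto
qed (use assms in auto)

text \<open>The \<open>SOME\<close> in \<open>ro_map\<close> is harmless: both candidate levels lift
  to the column of the larger index, where the level containing \<open>x\<close> is unique and the
  translation is the same.\<close>

lemma ro_map_level:
  assumes "x \<in> ro_level r s n k" "Suc k < ro_hgt r s n"
  shows "ro_map r s x = x - ro_lev r s n k + ro_lev r s n (Suc k)"
proof -
  define Q where "Q = (\<lambda>(n, k). Suc k < ro_hgt r s n \<and> x \<in> ro_level r s n k)"
  have "Q (n, k)" using assms by (simp add: Q_def)
  then have "Q (SOME q. Q q)" by (rule someI)
  moreover obtain n' k' where nk: "(SOME q. Q q) = (n', k')" by (rule prod.exhaust)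
  ultimately have *: "Suc k' < ro_hgt r s n'" "x \<in> ro_level r s n' k'" by (simp_all add: Q_def)
  let ?m = "max n n'"
  obtain l where l: "x \<in> ro_level r s ?m l" "Suc l < ro_hgt r s ?m"
    "ro_lev r s ?m (Suc l) - ro_lev r s ?m l = ro_lev r s n (Suc k) - ro_lev r s n k"
    using level_lift_step[OF assms, of ?m] by auto
  obtain l' where l': "x \<in> ro_level r s ?m l'" "Suc l' < ro_hgt r s ?m"
    "ro_lev r s ?m (Suc l') - ro_lev r s ?m l' = ro_lev r s n' (Suc k') - ro_lev r s n' k'"
    using level_lift_step[OF *(2,1), of ?m] by auto
  have "l = l'" using level_disjoint[OF l(1) l'(1)] l(2) l'(2) by simp
  moreover have "\<exists>n k. Suc k < ro_hgt r s n \<and> x \<in> ro_level r s n k" using assms by blast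
  then have "ro_map r s x = x - ro_lev r s n' k' + ro_lev r s n' (Suc k')"
    unfolding ro_map_def Q_def[symmetric] nk by (simp del: ro_lev.simps)
  ultimately show ?thesis using l(3) l'(3) by simp
qed

lemma ro_map_in_level:
  assumes "x \<in> ro_level r s n k" "Suc k < ro_hgt r s n"
  shows "ro_map r s x \<in> ro_level r s n (Suc k)"
  using assms unfolding ro_map_level[OF assms] ro_level_def by auto

lemma ro_map_space:
  assumes "x \<in> ro_space r s" shows "ro_map r s x \<in> ro_space r s"
proof (cases "\<exists>n k. Suc k < ro_hgt r s n \<and> x \<in> ro_level r s n k")
  case True
  then show ?thesis using ro_map_in_level unfolding ro_space_def by blast
next
  case False
  then show ?thesis using assms unfolding ro_map_def if_not_P[OF False] by simp
qed

end

lemma (in rank_one) ro_wid_le: "ro_wid r n \<le> (1/2) ^ n"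
proof (induction n)
  case (Suc n)
  have "ro_wid r n / real (r n + 1) \<le> (1/2) ^ n / 2"
    using Suc r_pos[of n] ro_wid_pos[of r n] by (intro frac_le) auto
  then show ?case by simp
qed simp

lemma (in rank_one) ro_wid_tendsto_0: "ro_wid r \<longlonglongrightarrow> 0"
proof (rule tendsto_sandwich[of "\<lambda>_. 0" _ _ "\<lambda>n. (1/2) ^ n"])
  show "\<forall>\<^sub>F n in sequentially. 0 \<le> ro_wid r n" using ro_wid_pos[of r] by (simp add: less_imp_le)
  show "\<forall>\<^sub>F n in sequentially. ro_wid r n \<le> (1/2) ^ n" using ro_wid_le by simp
qed (auto intro: LIMSEQ_realpow_zero)

text \<open>A point that stays in the top level has a fixed right endpoint of its level from some column on,
  while the widths tend to \<open>0\<close>; hence the exceptional set of the limit map is empty.\<close>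

lemma (in rank_one) nontop_level:
  assumes "x \<in> ro_space r s"
  shows "\<exists>m\<ge>N. \<exists>k. x \<in> ro_level r s m k \<and> Suc k < ro_hgt r s m"
proof -
  obtain n k where nk: "k < ro_hgt r s n" "x \<in> ro_level r s n k"
    using assms by (auto simp: ro_space_def)
  let ?R = "ro_lev r s n k + ro_wid r n"
  have *: "\<exists>k'<ro_hgt r s m. x \<in> ro_level r s m k' \<and>
      (Suc k' < ro_hgt r s m \<or> ro_lev r s m k' + ro_wid r m = ?R)" if "n \<le> m" for m
    using that
  proof (induction m rule: dec_induct)
    case (step m)
    then obtain k' where k': "k' < ro_hgt r s m" "x \<in> ro_level r s m k'"
      "Suc k' < ro_hgt r s m \<or> ro_lev r s m k' + ro_wid r m = ?R" by blast
    obtain i where i: "i \<le> r m" "x \<in> ro_level r s (Suc m) (ro_blockstart r s m i + k')"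
      by (rule level_lift[OF k'(2,1)])
    have less: "ro_blockstart r s m i + k' < ro_hgt r s (Suc m)"
      using blockstart_less[where r = r and s = s and n = m and d = k', OF i(1)] k'(1) by simp
    \<comment> \<open>A sublevel in the last subcolumn keeps the right endpoint; in any other
      subcolumn further levels lie above it.\<close>
    consider "Suc k' < ro_hgt r s m" | "i < r m" | "i = r m" "ro_lev r s m k' + ro_wid r m = ?R"
      using k'(3) i(1) by linarith
    then have "Suc (ro_blockstart r s m i + k') < ro_hgt r s (Suc m) \<or>
        ro_lev r s (Suc m) (ro_blockstart r s m i + k') + ro_wid r (Suc m) = ?R"
    proof cases
      case 1
      then show ?thesis using blockstart_less[where r = r and s = s and n = m and d = "Suc k'", OF i(1)] by simp
    next
      case 2
      have "ro_blockstart r s m (Suc i) < ro_hgt r s (Suc m)"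
        using blockstart_less[where i = "Suc i" and r = r and n = m and d = 0 and s = s] 2 ro_hgt_pos[of r s m] by simp
      moreover have "Suc (ro_blockstart r s m i + k') \<le> ro_blockstart r s m (Suc i)"
        using k'(1) by (simp add: ro_blockstart_def)
      ultimately show ?thesis by linarith
    next
      case 3
      have "ro_lev r s (Suc m) (ro_blockstart r s m i + k') + ro_wid r (Suc m)
          = ro_lev r s m k' + real (r m + 1) * ro_wid r (Suc m)"
        unfolding ro_lev_block[OF k'(1)] 3(1) by (simp only: of_nat_add distrib_right)
      then show ?thesis using 3(2) unfolding ro_wid_Suc[symmetric] by simp
    qed
    then show ?case using less i(2) by blast
  qed (use nk in auto)
  have "x < ?R" using nk by (simp add: ro_level_def)
  then have "\<forall>\<^sub>F m in sequentially. ro_wid r m < ?R - x"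
    using ro_wid_tendsto_0 by (intro order_tendstoD(2)) auto
  then obtain m0 where m0: "\<And>m. m \<ge> m0 \<Longrightarrow> ro_wid r m < ?R - x"
    by (auto simp: eventually_sequentially)
  obtain m where m: "m0 \<le> m" "n \<le> m" "N \<le> m" by (metis max.cobounded1 max.cobounded2 order.trans)
  obtain k' where k': "k' < ro_hgt r s m" "x \<in> ro_level r s m k'"
    "Suc k' < ro_hgt r s m \<or> ro_lev r s m k' + ro_wid r m = ?R"
    using *[OF m(2)] by blast
  have "ro_lev r s m k' + ro_wid r m \<noteq> ?R"
    using m0[OF m(1)] k'(2) by (auto simp: ro_level_def)
  then show ?thesis using k' m(3) by (intro exI[of _ m]) auto
qed

section \<open>A single gap yields an odometer\<close>

lemma emeasure_affine_image:
  fixes a t :: real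
  assumes "0 < a" "C \<in> sets borel"
  shows "(\<lambda>x. a * x + t) ` C \<in> sets borel"
    and "emeasure lborel ((\<lambda>x. a * x + t) ` C) = ennreal a * emeasure lborel C"
proof -
  let ?f = "\<lambda>x. a * x + t"
  have eq: "?f ` C = (\<lambda>y. (y - t) / a) -` C"
  proof (intro equalityI subsetI)
    fix y assume "y \<in> (\<lambda>y. (y - t) / a) -` C"
    then show "y \<in> ?f ` C" using assms(1) by (intro image_eqI[of _ _ "(y - t) / a"]) auto
  qed (use assms in auto)
  have "(\<lambda>y. (y - t) / a) \<in> borel_measurable borel" by measurable
  from measurable_sets[OF this assms(2)] show S: "?f ` C \<in> sets borel" using eq by simp
  have inj: "(\<lambda>x. t + a * x) -` (?f ` C) = C" using assms(1) by auto
  have "emeasure lborel (?f ` C)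
      = emeasure (density (distr lborel borel (\<lambda>x. t + a * x)) (\<lambda>_. ennreal \<bar>a\<bar>)) (?f ` C)"
    using lborel_real_affine[of a t] assms(1) by simp
  also have "\<dots> = ennreal \<bar>a\<bar> * emeasure (distr lborel borel (\<lambda>x. t + a * x)) (?f ` C)"
    using S by (intro emeasure_density_const) simp
  also have "emeasure (distr lborel borel (\<lambda>x. t + a * x)) (?f ` C) = emeasure lborel C"
    using S inj by (subst emeasure_distr) auto
  finally show "emeasure lborel (?f ` C) = ennreal a * emeasure lborel C" using assms(1) by simp
qed

locale piecewise_affine =
  fixes f :: "real \<Rightarrow> real" and X :: "real set" and D :: "nat \<Rightarrow> real set" and a :: real
    and t :: "nat \<Rightarrow> real"
  assumes a_pos: "0 < a"
    and cover: "X = (\<Union>i. D i)"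
    and D_borel: "D i \<in> sets borel"
    and f_affine: "x \<in> D i \<Longrightarrow> f x = a * x + t i"
    and f_inj: "inj_on f X"
begin

lemma X_borel: "X \<in> sets borel"
  unfolding cover using D_borel by auto

lemma f_measurable: "f \<in> borel_measurable (restrict_space borel X)"
proof (rule measurableI)
  fix S :: "real set" assume S: "S \<in> sets borel"
  have "f -` S \<inter> X = (\<Union>i. (\<lambda>x. a * x + t i) -` S \<inter> D i)"
    unfolding cover using f_affine by auto
  moreover have "(\<lambda>x. a * x + t i) -` S \<in> sets borel" for i
  proof -
    have "(\<lambda>x. a * x + t i) \<in> borel_measurable borel" by measurable
    from measurable_sets[OF this S] show ?thesis by simp
  qed
  then have "(\<Union>i. (\<lambda>x. a * x + t i) -` S \<inter> D i) \<in> sets borel" using D_borel by auto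
  ultimately show "f -` S \<inter> space (restrict_space borel X) \<in> sets (restrict_space borel X)"
    using X_borel by (auto simp: sets_restrict_space_iff space_restrict_space)
qed simp

lemma image_piece:
  assumes "C \<in> sets borel" "C \<subseteq> D i"
  shows "f ` C \<in> sets borel" "emeasure lborel (f ` C) = ennreal a * emeasure lborel C"
proof -
  have "f ` C = (\<lambda>x. a * x + t i) ` C" using assms(2) f_affine by (intro image_cong) auto
  then show "f ` C \<in> sets borel" "emeasure lborel (f ` C) = ennreal a * emeasure lborel C"
    using emeasure_affine_image[OF a_pos assms(1)] by simp_all
qed

text \<open>The pieces may overlap, so they are first made disjoint; by injectivity their images are
  disjoint as well, and countable additivity applies.\<close>

lemma image_measure:
  assumes "C \<in> sets borel" "C \<subseteq> X"
  shows "f ` C \<in> sets borel" "emeasure lborel (f ` C) = ennreal a * emeasure lborel C"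
proof -
  let ?P = "\<lambda>i. C \<inter> disjointed D i"
  have disj: "disjoint_family ?P"
    using disjoint_family_disjointed[of D] by (auto simp: disjoint_family_on_def)
  have P: "?P i \<in> sets borel" "?P i \<subseteq> D i" for i
  proof -
    have "range (disjointed D) \<subseteq> sets borel"
      using D_borel by (intro sets.range_disjointed_sets) auto
    then show "?P i \<in> sets borel" using assms(1) by auto
    show "?P i \<subseteq> D i" using disjointed_subset[of D i] by auto
  qed
  have C: "C = (\<Union>i. ?P i)"
    using assms(2) UN_disjointed_eq[of D] unfolding cover by auto
  then have fC: "f ` C = (\<Union>i. f ` ?P i)" by (metis image_UN)
  then show "f ` C \<in> sets borel" using image_piece(1)[OF P] by auto
  have "disjoint_family (\<lambda>i. f ` ?P i)"
    unfolding disjoint_family_on_def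
  proof (intro ballI impI)
    fix i j :: nat assume "i \<noteq> j"
    then have "?P i \<inter> ?P j = {}" using disj by (auto simp: disjoint_family_on_def)
    moreover have "f ` ?P i \<inter> f ` ?P j = f ` (?P i \<inter> ?P j)"
      by (rule inj_on_image_Int[OF f_inj, symmetric]) (use assms(2) in auto)
    ultimately show "f ` ?P i \<inter> f ` ?P j = {}" by simp
  qed
  then have "emeasure lborel (f ` C) = (\<Sum>i. emeasure lborel (f ` ?P i))"
    unfolding fC using image_piece(1)[OF P] by (intro suminf_emeasure[symmetric]) auto
  also have "\<dots> = (\<Sum>i. ennreal a * emeasure lborel (?P i))"
    using image_piece(2)[OF P] by simp
  also have "\<dots> = ennreal a * (\<Sum>i. emeasure lborel (?P i))" by simp
  also have "(\<Sum>i. emeasure lborel (?P i)) = emeasure lborel (\<Union>i. ?P i)"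
    using P(1) disj by (intro suminf_emeasure) auto
  finally show "emeasure lborel (f ` C) = ennreal a * emeasure lborel C" using C by simp
qed

text \<open>The inverse is of the same kind, which yields its measurability from
  \<open>f_measurable\<close>.\<close>

lemma inverse_affine: "piecewise_affine (the_inv_into X f) (f ` X) (\<lambda>i. f ` D i) (1 / a) (\<lambda>i. - t i / a)"
proof
  show "f ` X = (\<Union>i. f ` D i)" unfolding cover by (rule image_UN)
  show "f ` D i \<in> sets borel" for i using image_piece(1)[OF D_borel order.refl] .
  show "inj_on (the_inv_into X f) (f ` X)" using f_inj by (rule inj_on_the_inv_into)
  fix y i assume "y \<in> f ` D i"
  then obtain x where x: "x \<in> D i" "y = f x" by blast
  then have "the_inv_into X f y = x" using f_inj cover by (auto intro: the_inv_into_f_f)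
  then show "the_inv_into X f y = 1 / a * y + - t i / a"
    using x f_affine[OF x(1)] a_pos by (simp add: field_simps)
qed (use a_pos in simp)

end

section \<open>Isomorphism with an odometer when all gaps agree from some stage on\<close>

locale constant_gap = rank_one +
  fixes N e :: nat
  assumes const: "N \<le> m \<Longrightarrow> i < r m \<Longrightarrow> trailing r s m + s m i = e"
    and N_pos: "1 \<le> N"
begin

text \<open>The spacers still missing above column \<open>m\<close> to complete a gap
  \<open>e\<close>. From stage \<open>N\<close> on, \<open>trailing_le\<close> guarantees that the
  subtraction is not truncated.\<close>

definition c :: "nat \<Rightarrow> nat" where
  "c m = e - trailing r s m"

text \<open>\<open>U m\<close> is the constant return time to the base of the column \<open>m\<close>.\<close>

definition U :: "nat \<Rightarrow> nat" where
  "U m = ro_hgt r s m + c m"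

text \<open>The odometer first cuts \<open>[0,1)\<close> into \<open>U N\<close> levels and then copies the cuts of the given data
  from stage \<open>N\<close> on; its column \<open>j + 1\<close> corresponds to column \<open>N + j\<close>.\<close>

definition r' :: "nat \<Rightarrow> nat" where
  "r' k = (case k of 0 \<Rightarrow> U N - 1 | Suc j \<Rightarrow> r (N + j))"

definition s' :: "nat \<Rightarrow> nat \<Rightarrow> nat" where
  "s' k i = 0"

text \<open>The slope that rescales levels of column \<open>N\<close> to width
  \<open>1 / U N\<close>. It turns out to be the reciprocal of the measure of the space.\<close>

definition a :: real where
  "a = 1 / (real (U N) * ro_wid r N)"

lemma trailing_Suc: "trailing r s (Suc m) = trailing r s m + s m (r m)"
  by (simp add: trailing_def)

lemma trailing_le: "N \<le> m \<Longrightarrow> trailing r s m \<le> e"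
  using const[of m 0] r_pos[of m] by linarith

lemma s_c: "N \<le> m \<Longrightarrow> i < r m \<Longrightarrow> s m i = c m"
  using const[of m i] by (simp add: c_def)

lemma c_Suc: "N \<le> m \<Longrightarrow> s m (r m) + c (Suc m) = c m"
  using trailing_le[of "Suc m"] by (simp add: c_def trailing_Suc)

lemma c_le: "c m \<le> e"
  by (simp add: c_def)

lemma blockstart_U:
  assumes "N \<le> m" "i \<le> r m" shows "ro_blockstart r s m i = i * U m"
proof -
  have "ro_blockstart r s m i = (\<Sum>k<i. U m)"
    unfolding ro_blockstart_def using assms s_c by (intro sum.cong) (auto simp: U_def)
  then show ?thesis by simp
qed

lemma U_Suc: "N \<le> m \<Longrightarrow> U (Suc m) = (r m + 1) * U m"
proof -
  assume m: "N \<le> m"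
  have "ro_hgt r s (Suc m) = ro_blockstart r s m (r m) + (ro_hgt r s m + s m (r m))"
    unfolding ro_hgt_blockstart by (simp add: ro_blockstart_def)
  then have "U (Suc m) = r m * U m + ro_hgt r s m + (s m (r m) + c (Suc m))"
    using blockstart_U[OF m] by (simp add: U_def)
  then show ?thesis unfolding c_Suc[OF m] by (simp add: U_def)
qed

text \<open>At least one cut precedes stage \<open>N\<close>; the bound makes the first cut number
  \<open>U N - 1\<close> of the odometer positive.\<close>

lemma U_ge2: "2 \<le> U N"
proof -
  obtain n where N: "N = Suc n" using N_pos by (cases N) auto
  have "2 * 1 \<le> (r n + 1) * ro_hgt r s n"
    using r_pos[of n] ro_hgt_pos[of r s n] by (intro mult_mono) auto
  then show ?thesis unfolding U_def N by simp
qed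

sublocale odo: rank_one r' s'
proof
  fix n show "1 \<le> r' n" using U_ge2 r_pos by (cases n) (auto simp: r'_def)
qed

lemma hgt'_Suc: "ro_hgt r' s' (Suc j) = (r' j + 1) * ro_hgt r' s' j"
  by (simp add: s'_def)

text \<open>The odometer treats the \<open>c (N + j)\<close> missing spacers as ordinary levels on
  top of the column, so its heights are return times.\<close>

lemma hgt': "ro_hgt r' s' (Suc j) = U (N + j)"
proof (induction j)
  case 0
  show ?case using U_ge2 by (simp add: r'_def s'_def)
next
  case (Suc j)
  have "ro_hgt r' s' (Suc (Suc j)) = (r (N + j) + 1) * ro_hgt r' s' (Suc j)"
    unfolding hgt'_Suc[of "Suc j"] by (simp only: r'_def nat.case)
  then show ?case unfolding Suc using U_Suc[of "N + j"] by simp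
qed

lemma a_pos: "0 < a"
  using U_ge2 ro_wid_pos[of r N] by (simp add: a_def)

lemma wid': "ro_wid r' (Suc j) = a * ro_wid r (N + j)"
proof (induction j)
  case 0
  show ?case using U_ge2 ro_wid_pos[of r N] by (simp add: a_def r'_def)
next
  case (Suc j)
  have "ro_wid r' (Suc (Suc j)) = ro_wid r' (Suc j) / real (r (N + j) + 1)"
    unfolding ro_wid.simps(2)[of r' "Suc j"] by (simp add: r'_def)
  then show ?case unfolding Suc by simp
qed

lemma blockstart': "i \<le> r (N + j) \<Longrightarrow> ro_blockstart r' s' (Suc j) i = i * U (N + j)"
  by (simp add: ro_blockstart_def hgt' s'_def del: ro_hgt.simps)

lemma total': "real (ro_hgt r' s' (Suc j)) * ro_wid r' (Suc j) = 1"
proof (induction j)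
  case 0
  show ?case using U_ge2 by (simp add: r'_def s'_def)
next
  case (Suc j)
  show ?case using Suc unfolding hgt'_Suc[of "Suc j"] ro_wid_Suc[of r' "Suc j"]
    by (simp only: of_nat_mult mult.commute mult.left_commute)
qed

lemma space': "ro_space r' s' = {0..<1}"
proof
  have "ro_level r' s' 0 0 = {0..<1}" by (simp add: ro_level_def)
  then show "{0..<1} \<subseteq> ro_space r' s'" unfolding ro_space_def by fastforce
  have "ro_level r' s' n k \<subseteq> {0..<1}" if k: "k < ro_hgt r' s' n" for n k
  proof (cases n)
    case 0
    then show ?thesis using k by (simp add: ro_level_def)
  next
    case (Suc j)
    then show ?thesis using level_subset[OF k] unfolding Suc total' by (simp del: ro_hgt.simps)
  qed
  then show "ro_space r' s' \<subseteq> {0..<1}" unfolding ro_space_def by blast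
qed

definition transport :: "nat \<Rightarrow> nat \<Rightarrow> real \<Rightarrow> real" where
  "transport j k x = a * (x - ro_lev r s (N + j) k) + ro_lev r' s' (Suc j) k"

lemma transport_level:
  assumes "x \<in> ro_level r s (N + j) k"
  shows "transport j k x \<in> ro_level r' s' (Suc j) k"
proof -
  have "0 \<le> a * (x - ro_lev r s (N + j) k)" using assms a_pos by (simp add: ro_level_def)
  moreover have "a * (x - ro_lev r s (N + j) k) < a * ro_wid r (N + j)"
    using assms a_pos by (intro mult_strict_left_mono) (auto simp: ro_level_def)
  ultimately show ?thesis unfolding ro_level_def transport_def wid' by auto
qed

text \<open>Because the gap is constant, subcolumn \<open>i\<close> starts at height
  \<open>i * U (N + l)\<close> in both constructions, and its horizontal offset is \<open>i\<close>
  new widths in both. Hence refining the columns does not alter the transported point, which makes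
  \<open>\<phi>\<close> well defined.\<close>

lemma transport_lift:
  assumes "x \<in> ro_level r s (N + j) k" "k < ro_hgt r s (N + j)" "j \<le> j'"
  shows "\<exists>k'<ro_hgt r s (N + j'). x \<in> ro_level r s (N + j') k' \<and> transport j' k' x = transport j k x"
  using assms(3)
proof (induction j' rule: dec_induct)
  case (step l)
  then obtain k' where k': "k' < ro_hgt r s (N + l)" "x \<in> ro_level r s (N + l) k'"
    "transport l k' x = transport j k x" by blast
  obtain i where i: "i \<le> r (N + l)" "x \<in> ro_level r s (Suc (N + l)) (ro_blockstart r s (N + l) i + k')"
    by (rule level_lift[OF k'(2,1)])
  let ?k = "i * U (N + l) + k'"
  have bs: "ro_blockstart r s (N + l) i = i * U (N + l)" by (rule blockstart_U) (use i in auto)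
  have less: "?k < ro_hgt r s (N + Suc l)"
    using blockstart_less[where r = r and s = s and n = "N + l" and d = k', OF i(1)] k'(1)
    unfolding bs by simp
  have "k' < ro_hgt r' s' (Suc l)" unfolding hgt' using k'(1) by (simp add: U_def)
  then have lev': "ro_lev r' s' (Suc (Suc l)) ?k
      = ro_lev r' s' (Suc l) k' + real i * ro_wid r' (Suc (Suc l))"
    using ro_lev_block[of k' r' s' "Suc l" i] unfolding blockstart'[OF i(1)] by blast
  have lev: "ro_lev r s (Suc (N + l)) ?k = ro_lev r s (N + l) k' + real i * ro_wid r (Suc (N + l))"
    using ro_lev_block[OF k'(1), of i] unfolding bs .
  have "transport (Suc l) ?k x = transport l k' x"
    unfolding transport_def lev' wid' add_Suc_right lev by (simp only: algebra_simps)
  then show ?case using less i(2) k'(3) unfolding bs by auto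
qed (use assms in auto)

definition \<phi> :: "real \<Rightarrow> real" where
  "\<phi> x = (THE z. \<exists>j k. k < ro_hgt r s (N + j) \<and> x \<in> ro_level r s (N + j) k \<and> z = transport j k x)"

lemma \<phi>_transport:
  assumes "x \<in> ro_level r s (N + j) k" "k < ro_hgt r s (N + j)"
  shows "\<phi> x = transport j k x"
  unfolding \<phi>_def
proof (rule the_equality)
  fix z assume "\<exists>j k. k < ro_hgt r s (N + j) \<and> x \<in> ro_level r s (N + j) k \<and> z = transport j k x"
  then obtain j1 k1 where 1: "k1 < ro_hgt r s (N + j1)" "x \<in> ro_level r s (N + j1) k1"
    "z = transport j1 k1 x" by blast
  let ?m = "max j j1"
  obtain l where l: "l < ro_hgt r s (N + ?m)" "x \<in> ro_level r s (N + ?m) l"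
    "transport ?m l x = transport j k x"
    using transport_lift[OF assms, of ?m] by auto
  obtain l1 where l1: "l1 < ro_hgt r s (N + ?m)" "x \<in> ro_level r s (N + ?m) l1"
    "transport ?m l1 x = transport j1 k1 x"
    using transport_lift[OF 1(2,1), of ?m] by auto
  have "l = l1" using level_disjoint[OF l(2) l1(2) l(1) l1(1)] .
  then show "z = transport j k x" using 1(3) l(3) l1(3) by simp
qed (use assms in blast)

abbreviation X :: "real set" where
  "X \<equiv> ro_space r s"

lemma X_level:
  assumes "x \<in> X"
  obtains j0 where "\<And>j. j \<ge> j0 \<Longrightarrow> \<exists>k<ro_hgt r s (N + j). x \<in> ro_level r s (N + j) k"
proof -
  obtain n k where nk: "k < ro_hgt r s n" "x \<in> ro_level r s n k"
    using assms by (auto simp: ro_space_def)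
  show ?thesis
    by (rule that[of n]) (use level_lift_any[OF nk(2,1)] in auto)
qed

lemma level_X: "x \<in> ro_level r s n k \<Longrightarrow> k < ro_hgt r s n \<Longrightarrow> x \<in> X"
  by (auto simp: ro_space_def)

text \<open>Two points with the same image are lifted to a common column; images of different levels
  are disjoint, and on one level the map is affine with positive slope.\<close>

lemma \<phi>_inj: "inj_on \<phi> X"
proof (rule inj_onI)
  fix x y assume xy: "x \<in> X" "y \<in> X" "\<phi> x = \<phi> y"
  obtain jx where jx: "\<And>j. j \<ge> jx \<Longrightarrow> \<exists>k<ro_hgt r s (N + j). x \<in> ro_level r s (N + j) k"
    using X_level[OF xy(1)] by blast
  obtain jy where jy: "\<And>j. j \<ge> jy \<Longrightarrow> \<exists>k<ro_hgt r s (N + j). y \<in> ro_level r s (N + j) k"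
    using X_level[OF xy(2)] by blast
  let ?j = "max jx jy"
  obtain k where k: "k < ro_hgt r s (N + ?j)" "x \<in> ro_level r s (N + ?j) k" using jx[of ?j] by auto
  obtain l where l: "l < ro_hgt r s (N + ?j)" "y \<in> ro_level r s (N + ?j) l" using jy[of ?j] by auto
  have "k = l"
  proof (rule level_disjoint)
    show "\<phi> x \<in> ro_level r' s' (Suc ?j) k"
      unfolding \<phi>_transport[OF k(2,1)] by (rule transport_level[OF k(2)])
    show "\<phi> x \<in> ro_level r' s' (Suc ?j) l"
      unfolding xy(3) \<phi>_transport[OF l(2,1)] by (rule transport_level[OF l(2)])
  qed (use k(1) l(1) in \<open>auto simp: hgt' U_def simp del: ro_hgt.simps\<close>)
  then show "x = y"
    using xy(3) a_pos unfolding \<phi>_transport[OF k(2,1)] \<phi>_transport[OF l(2,1)] transport_def by simp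
qed

text \<open>A single index, decoded as a pair, enumerates the levels of all columns from stage
  \<open>N\<close> on; these cover the space.\<close>

definition piece :: "nat \<Rightarrow> real set" where
  "piece i = (case prod_decode i of (j, k) \<Rightarrow>
     if k < ro_hgt r s (N + j) then ro_level r s (N + j) k else {})"

definition shift :: "nat \<Rightarrow> real" where
  "shift i = (case prod_decode i of (j, k) \<Rightarrow>
     ro_lev r' s' (Suc j) k - a * ro_lev r s (N + j) k)"

sublocale pa: piecewise_affine \<phi> X piece a shift
proof
  show "X = (\<Union>i. piece i)"
  proof (intro equalityI subsetI)
    fix x assume "x \<in> X"
    then obtain j k where jk: "k < ro_hgt r s (N + j)" "x \<in> ro_level r s (N + j) k"
      using X_level by (metis order.refl)
    then have "x \<in> piece (prod_encode (j, k))" by (simp add: piece_def)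
    then show "x \<in> (\<Union>i. piece i)" by blast
  next
    fix x assume "x \<in> (\<Union>i. piece i)"
    then obtain i where i: "x \<in> piece i" by blast
    obtain j k where jk: "prod_decode i = (j, k)" by (rule prod.exhaust)
    show "x \<in> X"
      by (rule level_X[of _ "N + j" k]) (use i in \<open>simp_all add: piece_def jk split: if_splits\<close>)
  qed
  show "piece i \<in> sets borel" for i
    by (auto simp: piece_def ro_level_def split: prod.splits)
  fix x i assume x: "x \<in> piece i"
  obtain j k where jk: "prod_decode i = (j, k)" by (rule prod.exhaust)
  have "k < ro_hgt r s (N + j)" "x \<in> ro_level r s (N + j) k"
    using x by (auto simp: piece_def jk split: if_splits)
  then have "\<phi> x = transport j k x" by (rule \<phi>_transport[rotated])
  then show "\<phi> x = a * x + shift i"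
    by (simp add: shift_def jk transport_def right_diff_distrib)
qed (use a_pos \<phi>_inj in auto)

text \<open>By \<open>nontop_level\<close> every point lies below the top of some column of index at
  least \<open>N\<close>. There both maps are translations to the next level, and transport commutes
  with them; no null set has to be removed from \<open>X\<close>.\<close>

lemma \<phi>_conj:
  assumes "x \<in> X" shows "\<phi> (ro_map r s x) = ro_map r' s' (\<phi> x)"
proof -
  obtain m k where m: "m \<ge> N" "x \<in> ro_level r s m k" "Suc k < ro_hgt r s m"
    using nontop_level[OF assms] by blast
  then obtain j where j: "m = N + j" using le_Suc_ex by blast
  have x: "x \<in> ro_level r s (N + j) k" "Suc k < ro_hgt r s (N + j)" using m j by auto
  have \<phi>x: "\<phi> x = transport j k x" by (rule \<phi>_transport) (use x in auto)
  have "\<phi> x \<in> ro_level r' s' (Suc j) k" unfolding \<phi>x by (rule transport_level[OF x(1)])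
  moreover have "Suc k < ro_hgt r' s' (Suc j)" unfolding hgt' using x(2) by (simp add: U_def)
  ultimately have S: "ro_map r' s' (\<phi> x) = \<phi> x - ro_lev r' s' (Suc j) k + ro_lev r' s' (Suc j) (Suc k)"
    by (rule ro_map_level)
  have "\<phi> (ro_map r s x) = transport j (Suc k) (ro_map r s x)"
    by (rule \<phi>_transport[OF ro_map_in_level[OF x] x(2)])
  also have "\<dots> = \<phi> x - ro_lev r' s' (Suc j) k + ro_lev r' s' (Suc j) (Suc k)"
    unfolding \<phi>x ro_map_level[OF x] transport_def by (simp del: ro_lev.simps)
  finally show ?thesis unfolding S .
qed

lemma \<phi>_range: "\<phi> ` X \<subseteq> {0..<1}"
proof
  fix z assume "z \<in> \<phi> ` X"
  then obtain x where x: "x \<in> X" "z = \<phi> x" by blast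
  obtain j k where jk: "k < ro_hgt r s (N + j)" "x \<in> ro_level r s (N + j) k"
    using X_level[OF x(1)] by (metis order.refl)
  have "z \<in> ro_level r' s' (Suc j) k"
    unfolding x(2) \<phi>_transport[OF jk(2,1)] by (rule transport_level[OF jk(2)])
  moreover have "k < ro_hgt r' s' (Suc j)" unfolding hgt' using jk(1) by (simp add: U_def)
  ultimately show "z \<in> {0..<1}" unfolding space'[symmetric] ro_space_def by blast
qed

lemma level'_subset:
  assumes "k < ro_hgt r s (N + j)" shows "ro_level r' s' (Suc j) k \<subseteq> \<phi> ` X"
proof
  fix z assume z: "z \<in> ro_level r' s' (Suc j) k"
  define x where "x = (z - ro_lev r' s' (Suc j) k) / a + ro_lev r s (N + j) k"
  have "(z - ro_lev r' s' (Suc j) k) / a < ro_wid r (N + j)"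
    using z a_pos unfolding ro_level_def wid' by (simp add: pos_divide_less_eq mult.commute del: ro_lev.simps)
  moreover have "0 \<le> (z - ro_lev r' s' (Suc j) k) / a"
    using z a_pos unfolding ro_level_def by (simp del: ro_lev.simps)
  ultimately have x: "x \<in> ro_level r s (N + j) k" unfolding ro_level_def x_def by simp
  have "transport j k x = z"
    unfolding transport_def x_def using a_pos by (simp del: ro_lev.simps)
  then have "\<phi> x = z" unfolding \<phi>_transport[OF x assms] .
  then show "z \<in> \<phi> ` X" using level_X[OF x assms] by blast
qed

text \<open>The image contains all but \<open>c (N + j) \<le> e\<close> levels of odometer column
  \<open>j + 1\<close>, and the width of these levels tends to 0.\<close>

lemma emeasure_range: "emeasure lborel (\<phi> ` X) = 1"
proof (rule antisym)
  have "emeasure lborel (\<phi> ` X) \<le> emeasure lborel {0..<1::real}"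
    by (rule emeasure_mono[OF \<phi>_range]) simp
  then show "emeasure lborel (\<phi> ` X) \<le> 1" by simp
  have B: "\<phi> ` X \<in> sets borel" using pa.image_measure(1)[OF pa.X_borel] by simp
  have lower: "ennreal (1 - real e * ro_wid r' (Suc j)) \<le> emeasure lborel (\<phi> ` X)" for j
  proof -
    let ?h = "ro_hgt r s (N + j)" and ?w = "ro_wid r' (Suc j)" and ?I = "ro_level r' s' (Suc j)"
    have "real (U (N + j)) * ?w = 1" using total'[of j] unfolding hgt' .
    then have "real ?h * ?w = 1 - real (c (N + j)) * ?w"
      by (simp add: U_def distrib_right del: ro_wid.simps)
    moreover have "real (c (N + j)) * ?w \<le> real e * ?w"
      using c_le ro_wid_pos[of r' "Suc j"] by (intro mult_right_mono) auto
    ultimately have "ennreal (1 - real e * ?w) \<le> ennreal (real ?h * ?w)"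
      by (intro ennreal_leI) linarith
    also have "ennreal (real ?h * ?w) = (\<Sum>k<?h. emeasure lborel (?I k))"
      using ro_wid_pos[of r' "Suc j"]
      by (simp add: ro_level_def ennreal_mult'' less_imp_le ennreal_of_nat_eq_real_of_nat
          del: ro_wid.simps)
    also have "\<dots> = emeasure lborel (\<Union>k<?h. ?I k)"
    proof (rule sum_emeasure)
      show "disjoint_family_on ?I {..<?h}"
        unfolding disjoint_family_on_def
      proof (intro ballI impI)
        fix k l assume kl: "k \<in> {..<?h}" "l \<in> {..<?h}" "k \<noteq> l"
        have "k < ro_hgt r' s' (Suc j)" "l < ro_hgt r' s' (Suc j)"
          unfolding hgt' U_def using kl by auto
        then show "?I k \<inter> ?I l = {}" using level_disjoint[of _ r' s' "Suc j" k l] kl(3) by blast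
      qed
    qed (auto simp: ro_level_def)
    also have "\<dots> \<le> emeasure lborel (\<phi> ` X)"
      using level'_subset B by (intro emeasure_mono) auto
    finally show ?thesis .
  qed
  have "(\<lambda>j. ennreal (1 - real e * ro_wid r' (Suc j))) \<longlonglongrightarrow> ennreal (1 - real e * 0)"
    by (intro tendsto_ennrealI tendsto_intros LIMSEQ_Suc odo.ro_wid_tendsto_0)
  then show "1 \<le> emeasure lborel (\<phi> ` X)"
    using lower by (intro LIMSEQ_le_const2[of _ 1 "emeasure lborel (\<phi> ` X)"]) auto
qed

text \<open>Since \<open>\<phi>\<close> multiplies Lebesgue measure by \<open>a\<close> and has
  image of measure 1, \<open>a\<close> is the normalizing factor in \<open>ro_measure\<close>; so
  \<open>\<phi>\<close> preserves the normalized measures.\<close>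

lemma a_emeasure_X: "ennreal a * emeasure lborel X = 1"
  using pa.image_measure(2)[OF pa.X_borel order.refl] emeasure_range by simp

lemma inverse_emeasure_X: "inverse (emeasure lborel X) = ennreal a"
proof -
  have "emeasure lborel X \<noteq> top" using a_emeasure_X a_pos by (auto simp: ennreal_mult_top)
  then obtain v where v: "0 \<le> v" "emeasure lborel X = ennreal v" by (cases "emeasure lborel X") auto
  have "ennreal (a * v) = 1" using a_emeasure_X a_pos v by (simp add: ennreal_mult)
  then have "a * v = 1" by (simp add: ennreal_eq_1)
  then have "v = 1 / a" using a_pos by (simp add: field_simps)
  then show ?thesis using v a_pos by (simp add: inverse_ennreal)
qed

lemma mt_iso_odometer: "mt_iso (ro_measure r s) (ro_map r s) (ro_measure r' s') (ro_map r' s')"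
proof -
  let ?M = "ro_measure r s" and ?N = "ro_measure r' s'" and ?B = "\<phi> ` X"
  have B: "?B \<in> sets borel" using pa.image_measure(1)[OF pa.X_borel] by simp
  have sp: "space ?M = X" "space ?N = {0..<1}"
    by (simp_all add: ro_measure_def space_scale_measure space_restrict_space space')
  have sM: "sets ?M = sets (restrict_space borel X)"
    by (simp add: ro_measure_def sets_restrict_space)
  have sN: "sets ?N = sets (restrict_space borel {0..<1::real})"
    by (simp add: ro_measure_def sets_restrict_space space')
  have rM: "sets (restrict_space ?M X) = sets (restrict_space borel X)"
    by (simp add: sets_restrict_space sM)
      (metis sets_restrict_space sets_restrict_restrict_space Int_absorb)
  have rN: "sets (restrict_space ?N ?B) = sets (restrict_space borel ?B)"
    using \<phi>_range by (simp add: sets_restrict_space_cong[OF sN] sets_restrict_restrict_space Int_absorb1)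
  have mem_M: "C \<in> sets (restrict_space borel X) \<longleftrightarrow> C \<in> sets borel \<and> C \<subseteq> X" for C
    using pa.X_borel by (auto simp: sets_restrict_space_iff)
  have eM: "emeasure ?M C = ennreal a * emeasure lborel C" if "C \<in> sets borel" "C \<subseteq> X" for C
    using that pa.X_borel
    by (simp add: ro_measure_def emeasure_restrict_space inverse_emeasure_X)
  have eN: "emeasure ?N C = emeasure lborel C" if "C \<in> sets borel" "C \<subseteq> {0..<1}" for C
    using that by (simp add: ro_measure_def emeasure_restrict_space space')
  interpret inv: piecewise_affine "the_inv_into X \<phi>" ?B "\<lambda>i. \<phi> ` piece i" "1 / a" "\<lambda>i. - shift i / a"
    by (rule pa.inverse_affine)
  show ?thesis
    unfolding mt_iso_def
  \<comment> \<open>The domain is the whole space; the codomain is the image of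
    \<open>\<phi>\<close>, of full measure by \<open>emeasure_range\<close> and invariant by
    \<open>\<phi>_conj\<close>.\<close>
  proof (rule exI[of _ X], rule exI[of _ ?B], rule exI[of _ \<phi>], intro conjI ballI)
    show "X \<in> sets ?M" unfolding sM using mem_M pa.X_borel by blast
    show "?B \<in> sets ?N" unfolding sN using B \<phi>_range by (simp add: sets_restrict_space_iff)
    show "emeasure ?M (space ?M - X) = 0" unfolding sp by simp
    have "emeasure ?N (space ?N - ?B) = emeasure lborel ({0..<1} - ?B)"
      unfolding sp using B by (intro eN) auto
    also have "\<dots> = emeasure lborel {0..<1::real} - emeasure lborel ?B"
      using B \<phi>_range emeasure_range by (intro emeasure_Diff) auto
    also have "\<dots> = 0" using emeasure_range by simp
    finally show "emeasure ?N (space ?N - ?B) = 0" .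
    show "ro_map r s ` X \<subseteq> X" using ro_map_space by blast
    show "ro_map r' s' ` ?B \<subseteq> ?B"
    proof (intro image_subsetI)
      fix z assume "z \<in> ?B"
      then obtain x where x: "x \<in> X" "z = \<phi> x" by blast
      show "ro_map r' s' z \<in> ?B"
        unfolding x(2) \<phi>_conj[OF x(1), symmetric] using ro_map_space[OF x(1)] by (rule imageI)
    qed
    show "bij_betw \<phi> X ?B" using \<phi>_inj by (rule inj_on_imp_bij_betw)
    show "\<phi> \<in> restrict_space ?M X \<rightarrow>\<^sub>M restrict_space ?N ?B"
      unfolding measurable_cong_sets[OF rM rN]
      using pa.f_measurable by (intro measurable_restrict_space2) (auto simp: space_restrict_space)
    show "the_inv_into X \<phi> \<in> restrict_space ?N ?B \<rightarrow>\<^sub>M restrict_space ?M X"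
      unfolding measurable_cong_sets[OF rN rM]
      using inv.f_measurable \<phi>_inj
      by (intro measurable_restrict_space2) (auto simp: space_restrict_space the_inv_into_f_f)
  next
    fix C assume "C \<in> sets (restrict_space ?M X)"
    then have C: "C \<in> sets borel" "C \<subseteq> X" unfolding rM mem_M by auto
    have "\<phi> ` C \<subseteq> {0..<1}" using C(2) \<phi>_range by blast
    then show "emeasure ?N (\<phi> ` C) = emeasure ?M C"
      using eM[OF C] eN[of "\<phi> ` C"] pa.image_measure[OF C] by simp
  next
    fix x assume "x \<in> X" then show "\<phi> (ro_map r s x) = ro_map r' s' (\<phi> x)" by (rule \<phi>_conj)
  qed
qed

lemma odometer: "ro_odometer r s"
  unfolding ro_odometer_def
proof (intro exI[of _ r'] exI[of _ s'] conjI mt_iso_odometer)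
  show "ro_valid r' s'" using odo.r_pos by (simp add: ro_valid_def s'_def)
  show "\<exists>N. \<forall>n\<ge>N. \<forall>i<r' n. s' n i = 0" by (simp add: s'_def)
qed

end

theorem theorem3p2:
  fixes r :: "nat \<Rightarrow> nat" and s :: "nat \<Rightarrow> nat \<Rightarrow> nat"
  assumes "ro_valid r s"
    and "\<not> ro_odometer r s"
  shows "limsup (\<lambda>q. ereal (real (ro_complexity r s q) - 3/2 * real q)) = \<infinity>
         \<and> liminf (\<lambda>q. ereal (real (ro_complexity r s q) - real q)) = \<infinity>"
proof -
  interpret rank_one r s using assms(1) by unfold_locales (simp add: ro_valid_def)
  have "gap_set n \<noteq> {e}" for n e
  proof
    assume gap_set: "gap_set n = {e}"
    \<comment> \<open>A singleton gap set makes all gaps from stage \<open>n\<close> on equal to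
      \<open>e\<close>. Starting at \<open>Suc n\<close> makes the stage positive, as
      \<open>N_pos\<close> demands.\<close>
    have "constant_gap r s (Suc n) e"
    proof unfold_locales
      fix m i assume m: "Suc n \<le> m" "i < r m"
      then have "trailing r s m + s m i \<in> set (gap_list r s m)" by (simp add: gap_list_def)
      then have "trailing r s m + s m i \<in> gap_set n" unfolding gap_set_def using m by auto
      then show "trailing r s m + s m i = e" using gap_set by simp
    qed simp
    then show False using assms(2) constant_gap.odometer by blast
  qed
  then show ?thesis using complexity_limits by blast
qed

end
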